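(* Let $n\ge1$ and $1\le n_1\le n_2\le n$ be integers, and let $\mathcal{B}_{\langle k'\rangle}$ ($k'\in\mathbb{Z}$) be the $\mathfrak{sp}(2n,\mathbb{C})$-module defined in the context. For any $k'\in\mathbb{Z}$, if the $\mathfrak{sp}(2n,\mathbb{C})$-module $\mathcal{B}_{\langle k'\rangle}$ is irreducible, then it has Gelfand-Kirillov dimension $d=2n-1$. When $n_1=n_2$, the $\mathfrak{sp}(2n,\mathbb{C})$-module $\mathcal{B}_{\langle 0\rangle}$ also has Gelfand-Kirillov dimension $d=2n-1$. When $n_1=n_2=n$, the two irreducible components of $\mathcal{B}_{\langle 0\rangle}$ also have Gelfand-Kirillov dimension $d=2n-1$.
   Context: $\mathbb{N}$ denotes the nonnegative integers. $E_{r,s}$ is the $2n\times2n$ matrix with $1$ in entry $(r,s)$ and $0$ elsewhere. The symplectic Lie algebra is $$\mathfrak{sp}(2n,\mathbb{C})=\sum_{i,j=1}^n\mathbb{C}(E_{i,j}-E_{n+j,n+i})+\sum_{i=1}^n(\mathbb{C}E_{i,n+i}+\mathbb{C}E_{n+i,i})+\sum_{1\le i<j\le n}[\mathbb{C}(E_{i,n+j}+E_{j,n+i})+\mathbb{C}(E_{n+i,j}+E_{n+j,i})].$$ Let $\mathcal{B}=\mathbb{C}[x_1,\dots,x_n,y_1,\dots,y_n]$ and fix $1\le n_1\le n_2\le n$. The (two-parameter $\mathbb{Z}$-graded oscillator) representation of $\mathfrak{sp}(2n,\mathbb{C})$ on $\mathcal{B}$ is obtained by taking linear combinations of the following assignments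 of differential operators, for $i,j\in\{1,\dots,n\}$. (1) $(E_{i,j}-E_{n+j,n+i})|_{\mathcal{B}}=E^x_{i,j}-E^y_{j,i}$, where $E^x_{i,j}=-x_j\partial_{x_i}-\delta_{i,j}$ if $i,j\le n_1$; $E^x_{i,j}=\partial_{x_i}\partial_{x_j}$ if $i\le n_1<j$; $E^x_{i,j}=-x_ix_j$ if $j\le n_1<i$; $E^x_{i,j}=x_i\partial_{x_j}$ if $i,j>n_1$; and $E^y_{i,j}=y_i\partial_{y_j}$ if $i,j\le n_2$; $E^y_{i,j}=-y_iy_j$ if $i\le n_2<j$; $E^y_{i,j}=\partial_{y_i}\partial_{y_j}$ if $j\le n_2<i$; $E^y_{i,j}=-y_j\partial_{y_i}-\delta_{i,j}$ if $i,j>n_2$. (2) $E_{i,n+j}|_{\mathcal{B}}=\partial_{x_i}\partial_{y_j}$ if $i\le n_1,\ j\le n_2$; $=-y_j\partial_{x_i}$ if $i\le n_1,\ j>n_2$; $=x_i\partial_{y_j}$ if $i>n_1,\ j\le n_2$; $=-x_iy_j$ if $i>n_1,\ j>n_2$. (3) $E_{n+i,j}|_{\mathcal{B}}=-x_jy_i$ if $j\le n_1,\ i\le n_2$; $=-x_j\partial_{y_i}$ if $j\le n_1,\ i>n_2$; $=y_i\partial_{x_j}$ if $j>n_1,\ i\le n_2$; $=\partial_{x_j}\partial_{y_i}$ if $j>n_1,\ i>n_2$. For $k'\in\mathbb{Z}$ put $$\mathcal{B}_{\langle k'\rangle}=\mathrm{Span}\Big\{x^\alpha y^\beta : \alpha,\beta\in\mathbb{N}^n,\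 \sum_{r=n_1+1}^n\alpha_r-\sum_{i=1}^{n_1}\alpha_i+\sum_{i=1}^{n_2}\beta_i-\sum_{r=n_2+1}^n\beta_r=k'\Big\},$$ an $\mathfrak{sp}(2n,\mathbb{C})$-submodule of $\mathcal{B}$. It is known (Luo–Xu) that when $n_1=n_2$ the module $\mathcal{B}_{\langle0\rangle}$ is a direct sum of two irreducible submodules; if $n_1=n_2=n$ these are highest-weight modules with highest-weight vectors $1$ and $x_{n-1}y_n-x_ny_{n-1}$ respectively (with respect to the positive part spanned by $E_{i,j}-E_{n+j,n+i}$ and $E_{i,n+j}+E_{j,n+i}$ for $1\le i<j\le n$, and $E_{i,n+i}$ for $1\le i\le n$). These are "the two irreducible components". Gelfand-Kirillov dimension: for a complex Lie algebra $\mathfrak{g}$ and a $U(\mathfrak{g})$-module $M$ generated by a finite-dimensional subspace $M_0$, let $U_k(\mathfrak{g})$ be the span of products of at most $k$ elements of $\mathfrak{g}$; the Gelfand-Kirillov dimension of $M$ is $\limsup_{k\to\infty}\frac{\log\dim(U_k(\mathfrak{g})M_0)}{\log k}$ (independent of the choice of $M_0$). *)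

theory Defs
  imports
    "HOL-Analysis.Analysis"
    "HOL-Library.Poly_Mapping"
    "HOL-Library.Function_Algebras"
begin

section \<open>Modules over a Lie algebra and Gelfand-Kirillov dimension\<close>

text \<open>
  A module over a Lie algebra \<open>g\<close> is given by its action \<open>act\<close> on the ambient vector space:
  \<open>act a\<close> is the operator by which \<open>a \<in> g\<close> acts, and \<open>smul\<close> is the
  scalar multiplication. A \<open>U(g)\<close>-submodule is then a subspace that is stable under
  all \<open>act a\<close>, and \<open>env_filt smul act g k M\<^sub>0\<close> is \<open>U\<^sub>k(g) M\<^sub>0\<close>, where \<open>U\<^sub>k(g)\<close> is spanned
  by the products of at most \<open>k\<close> elements of \<open>g\<close> (the empty product being 1).
\<close>

definition lie_submodule ::
    "(complex \<Rightarrow> 'b::ab_group_add \<Rightarrow> 'b) \<Rightarrow> ('g \<Rightarrow> 'b \<Rightarrow> 'b) \<Rightarrow> 'g set \<Rightarrow> 'b set \<Rightarrow> bool" where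
  "lie_submodule smul act g M \<longleftrightarrow>
     module.subspace smul M \<and> (\<forall>a\<in>g. \<forall>v\<in>M. act a v \<in> M)"

definition lie_irreducible ::
    "(complex \<Rightarrow> 'b::ab_group_add \<Rightarrow> 'b) \<Rightarrow> ('g \<Rightarrow> 'b \<Rightarrow> 'b) \<Rightarrow> 'g set \<Rightarrow> 'b set \<Rightarrow> bool" where
  "lie_irreducible smul act g M \<longleftrightarrow> lie_submodule smul act g M \<and> M \<noteq> {0} \<and>
     (\<forall>N. lie_submodule smul act g N \<longrightarrow> N \<subseteq> M \<longrightarrow> N = {0} \<or> N = M)"

definition env_filt ::
    "(complex \<Rightarrow> 'b::ab_group_add \<Rightarrow> 'b) \<Rightarrow> ('g \<Rightarrow> 'b \<Rightarrow> 'b) \<Rightarrow> 'g set \<Rightarrow> nat \<Rightarrow> 'b set \<Rightarrow> 'b set" where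
  "env_filt smul act g k M\<^sub>0 =
     module.span smul {foldr act as v | as v. set as \<subseteq> g \<and> length as \<le> k \<and> v \<in> M\<^sub>0}"

text \<open>The submodule \<open>U(g) M\<^sub>0\<close> generated by \<open>M\<^sub>0\<close>:\<close>

definition env_gen ::
    "(complex \<Rightarrow> 'b::ab_group_add \<Rightarrow> 'b) \<Rightarrow> ('g \<Rightarrow> 'b \<Rightarrow> 'b) \<Rightarrow> 'g set \<Rightarrow> 'b set \<Rightarrow> 'b set" where
  "env_gen smul act g M\<^sub>0 = (\<Union>k. env_filt smul act g k M\<^sub>0)"

definition fin_dim_subspace :: "(complex \<Rightarrow> 'b::ab_group_add \<Rightarrow> 'b) \<Rightarrow> 'b set \<Rightarrow> bool" where
  "fin_dim_subspace smul M\<^sub>0 \<longleftrightarrow> (\<exists>B. finite B \<and> M\<^sub>0 = module.span smul B)"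

text \<open>
  \<open>M\<close> has Gelfand-Kirillov dimension \<open>d\<close>: it is generated by some finite-dimensional subspace, and
  the defining limit superior is \<open>d\<close> for every choice of such a subspace.
\<close>

definition has_GK_dim ::
    "(complex \<Rightarrow> 'b::ab_group_add \<Rightarrow> 'b) \<Rightarrow> ('g \<Rightarrow> 'b \<Rightarrow> 'b) \<Rightarrow> 'g set \<Rightarrow> 'b set \<Rightarrow> ereal \<Rightarrow> bool" where
  "has_GK_dim smul act g M d \<longleftrightarrow> lie_submodule smul act g M \<and>
     (\<exists>M\<^sub>0. fin_dim_subspace smul M\<^sub>0 \<and> env_gen smul act g M\<^sub>0 = M) \<and>
     (\<forall>M\<^sub>0. fin_dim_subspace smul M\<^sub>0 \<and> env_gen smul act g M\<^sub>0 = M \<longrightarrow>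
        limsup (\<lambda>k. ereal (ln (real (vector_space.dim smul (env_filt smul act g k M\<^sub>0)))
                             / ln (real k))) = d)"

definition irreducible_components ::
    "(complex \<Rightarrow> 'b::ab_group_add \<Rightarrow> 'b) \<Rightarrow> ('g \<Rightarrow> 'b \<Rightarrow> 'b) \<Rightarrow> 'g set \<Rightarrow> 'b set \<Rightarrow> 'b set \<Rightarrow> 'b set \<Rightarrow> bool" where
  "irreducible_components smul act g W M N \<longleftrightarrow>
     lie_irreducible smul act g M \<and> lie_irreducible smul act g N \<and>
     M \<inter> N = {0} \<and> {u + v | u v. u \<in> M \<and> v \<in> N} = W"

section \<open>The symplectic Lie algebra\<close>

text \<open>
  A \<open>2n \<times> 2n\<close> matrix is a function \<open>nat \<Rightarrow> nat \<Rightarrow> complex\<close>, with rows and columns indexed from 1 and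
  with zeros outside of \<open>{1..2n} \<times> {1..2n}\<close>.
\<close>

type_synonym cmat = "nat \<Rightarrow> nat \<Rightarrow> complex"

definition mat_scale :: "complex \<Rightarrow> cmat \<Rightarrow> cmat" where
  "mat_scale c A = (\<lambda>r s. c * A r s)"

global_interpretation cmat: vector_space mat_scale
  by unfold_locales (auto simp: mat_scale_def fun_eq_iff algebra_simps)

definition Emat :: "nat \<Rightarrow> nat \<Rightarrow> cmat" where
  "Emat r s = (\<lambda>a b. if a = r \<and> b = s then 1 else 0)"

definition sp :: "nat \<Rightarrow> cmat set" where
  "sp n = cmat.span (
      {Emat i j - Emat (n + j) (n + i) | i j. i \<in> {1..n} \<and> j \<in> {1..n}}
    \<union> {Emat i (n + i) | i. i \<in> {1..n}} \<union> {Emat (n + i) i | i. i \<in> {1..n}}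
    \<union> {Emat i (n + j) + Emat j (n + i) | i j. 1 \<le> i \<and> i < j \<and> j \<le> n}
    \<union> {Emat (n + i) j + Emat (n + j) i | i j. 1 \<le> i \<and> i < j \<and> j \<le> n})"

section \<open>Polynomials and differential operators\<close>

text \<open>
  The polynomial ring is the monoid algebra of the free commutative monoid \<open>var \<Rightarrow>\<^sub>0 nat\<close> of monomials.
  It has variables \<open>x\<^sub>i\<close>, \<open>y\<^sub>i\<close> for all \<open>i :: nat\<close>; only those with \<open>1 \<le> i \<le> n\<close> occur in \<open>B_deg\<close>.
\<close>

datatype var = VX nat | VY nat

type_synonym cpoly = "(var \<Rightarrow>\<^sub>0 nat) \<Rightarrow>\<^sub>0 complex"

definition poly_scale :: "complex \<Rightarrow> cpoly \<Rightarrow> cpoly" where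
  "poly_scale c p = Poly_Mapping.single 0 c * p"

global_interpretation cpoly: vector_space poly_scale
  by unfold_locales
    (auto simp: poly_scale_def algebra_simps single_add mult_single simp flip: mult.assoc)

definition xv :: "nat \<Rightarrow> cpoly" where
  "xv i = Poly_Mapping.single (Poly_Mapping.single (VX i) 1) 1"

definition yv :: "nat \<Rightarrow> cpoly" where
  "yv i = Poly_Mapping.single (Poly_Mapping.single (VY i) 1) 1"

text \<open>In the next definition, monomials not containing \<open>v\<close> contribute 0 because of the coefficient.\<close>

definition pdiff :: "var \<Rightarrow> cpoly \<Rightarrow> cpoly" where
  "pdiff v p = (\<Sum>m\<in>Poly_Mapping.keys p.
     Poly_Mapping.single (m - Poly_Mapping.single v 1)
       (of_nat (Poly_Mapping.lookup m v) * Poly_Mapping.lookup p m))"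

abbreviation dx :: "nat \<Rightarrow> cpoly \<Rightarrow> cpoly" where "dx i \<equiv> pdiff (VX i)"
abbreviation dy :: "nat \<Rightarrow> cpoly \<Rightarrow> cpoly" where "dy i \<equiv> pdiff (VY i)"

section \<open>The two-parameter oscillator representation\<close>

definition Exx :: "nat \<Rightarrow> nat \<Rightarrow> nat \<Rightarrow> cpoly \<Rightarrow> cpoly" where
  "Exx n1 i j p =
     (if i \<le> n1 \<and> j \<le> n1 then - (xv j * dx i p) - (if i = j then p else 0)
      else if i \<le> n1 \<and> n1 < j then dx i (dx j p)
      else if j \<le> n1 \<and> n1 < i then - (xv i * xv j * p)
      else xv i * dx j p)"

definition Eyy :: "nat \<Rightarrow> nat \<Rightarrow> nat \<Rightarrow> cpoly \<Rightarrow> cpoly" where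
  "Eyy n2 i j p =
     (if i \<le> n2 \<and> j \<le> n2 then yv i * dy j p
      else if i \<le> n2 \<and> n2 < j then - (yv i * yv j * p)
      else if j \<le> n2 \<and> n2 < i then dy i (dy j p)
      else - (yv j * dy i p) - (if i = j then p else 0))"

text \<open>
  \<open>Exx n1 i j\<close> and \<open>Eyy n2 i j\<close> above are \<open>E\<^sup>x\<^bsub>i,j\<^esub>\<close> and \<open>E\<^sup>y\<^bsub>i,j\<^esub>\<close>, and
  \<open>Eup n1 n2 i j\<close> and \<open>Elow n1 n2 i j\<close> are the operators assigned to \<open>E\<^bsub>i,n+j\<^esub>\<close> and \<open>E\<^bsub>n+i,j\<^esub>\<close>.
\<close>

definition Eup :: "nat \<Rightarrow> nat \<Rightarrow> nat \<Rightarrow> nat \<Rightarrow> cpoly \<Rightarrow> cpoly" where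
  "Eup n1 n2 i j p =
     (if i \<le> n1 \<and> j \<le> n2 then dx i (dy j p)
      else if i \<le> n1 \<and> n2 < j then - (yv j * dx i p)
      else if n1 < i \<and> j \<le> n2 then xv i * dy j p
      else - (xv i * yv j * p))"

definition Elow :: "nat \<Rightarrow> nat \<Rightarrow> nat \<Rightarrow> nat \<Rightarrow> cpoly \<Rightarrow> cpoly" where
  "Elow n1 n2 i j p =
     (if j \<le> n1 \<and> i \<le> n2 then - (xv j * yv i * p)
      else if j \<le> n1 \<and> n2 < i then - (xv j * dy i p)
      else if n1 < j \<and> i \<le> n2 then yv i * dx j p
      else dx j (dy i p))"

text \<open>
  Every \<open>A\<close> in \<open>sp n\<close> is
  \<open>\<Sum>\<^sub>i\<^sub>,\<^sub>j A\<^bsub>i,j\<^esub> (E\<^bsub>i,j\<^esub> - E\<^bsub>n+j,n+i\<^esub>) + \<Sum>\<^sub>i\<^sub>,\<^sub>j A\<^bsub>i,n+j\<^esub> E\<^bsub>i,n+j\<^esub> + \<Sum>\<^sub>i\<^sub>,\<^sub>j A\<^bsub>n+i,j\<^esub> E\<^bsub>n+i,j\<^esub>\<close>;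
  \<open>osc n n1 n2 A\<close> is the corresponding linear combination of operators. The lemmas below record
  its values on the spanning set of \<open>sp n\<close>.
\<close>

definition osc :: "nat \<Rightarrow> nat \<Rightarrow> nat \<Rightarrow> cmat \<Rightarrow> cpoly \<Rightarrow> cpoly" where
  "osc n n1 n2 A p = (\<Sum>i=1..n. \<Sum>j=1..n.
       poly_scale (A i j) (Exx n1 i j p - Eyy n2 j i p)
     + poly_scale (A i (n + j)) (Eup n1 n2 i j p)
     + poly_scale (A (n + i) j) (Elow n1 n2 i j p))"

lemma osc_add: "osc n n1 n2 (A + B) p = osc n n1 n2 A p + osc n n1 n2 B p"
  unfolding osc_def sum.distrib[symmetric]
  by (intro sum.cong refl) (simp add: cpoly.scale_left_distrib)

lemma osc_scale: "osc n n1 n2 (mat_scale c A) p = poly_scale c (osc n n1 n2 A p)"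
  by (simp add: osc_def mat_scale_def cpoly.scale_sum_right cpoly.scale_right_distrib)

lemma double_sum_delta:
  fixes f :: "nat \<Rightarrow> nat \<Rightarrow> cpoly"
  assumes "i \<in> {1..n}" "j \<in> {1..n}"
  shows "(\<Sum>a=1..n. \<Sum>b=1..n. if a = i \<and> b = j then f a b else 0) = f i j"
proof -
  have "(\<Sum>b=1..n. if a = i \<and> b = j then f a b else 0) = (if a = i then f i j else 0)" for a
    using assms by (auto simp: sum.delta)
  then show ?thesis using assms by (simp add: sum.delta)
qed

lemma osc_E_diag:
  assumes "i \<in> {1..n}" "j \<in> {1..n}"
  shows "osc n n1 n2 (Emat i j - Emat (n + j) (n + i)) p = Exx n1 i j p - Eyy n2 j i p"
proof -
  have "osc n n1 n2 (Emat i j - Emat (n + j) (n + i)) p =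
    (\<Sum>a=1..n. \<Sum>b=1..n. if a = i \<and> b = j then Exx n1 a b p - Eyy n2 b a p else 0)"
    unfolding osc_def using assms by (intro sum.cong refl) (auto simp: Emat_def)
  then show ?thesis using double_sum_delta[OF assms] by simp
qed

lemma osc_E_up:
  assumes "i \<in> {1..n}" "j \<in> {1..n}"
  shows "osc n n1 n2 (Emat i (n + j)) p = Eup n1 n2 i j p"
proof -
  have "osc n n1 n2 (Emat i (n + j)) p =
    (\<Sum>a=1..n. \<Sum>b=1..n. if a = i \<and> b = j then Eup n1 n2 a b p else 0)"
    unfolding osc_def using assms by (intro sum.cong refl) (auto simp: Emat_def)
  then show ?thesis using double_sum_delta[OF assms] by simp
qed

lemma osc_E_low:
  assumes "i \<in> {1..n}" "j \<in> {1..n}"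
  shows "osc n n1 n2 (Emat (n + i) j) p = Elow n1 n2 i j p"
proof -
  have "osc n n1 n2 (Emat (n + i) j) p =
    (\<Sum>a=1..n. \<Sum>b=1..n. if a = i \<and> b = j then Elow n1 n2 a b p else 0)"
    unfolding osc_def using assms by (intro sum.cong refl) (auto simp: Emat_def)
  then show ?thesis using double_sum_delta[OF assms] by simp
qed

text \<open>Only the values of \<open>\<alpha>\<close> and \<open>\<beta>\<close> on \<open>{1..n}\<close> matter here.\<close>

definition B_deg :: "nat \<Rightarrow> nat \<Rightarrow> nat \<Rightarrow> int \<Rightarrow> cpoly set" where
  "B_deg n n1 n2 k' = cpoly.span
     {(\<Prod>i=1..n. xv i ^ \<alpha> i) * (\<Prod>i=1..n. yv i ^ \<beta> i) | \<alpha> \<beta> :: nat \<Rightarrow> nat.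
        (\<Sum>r=n1+1..n. int (\<alpha> r)) - (\<Sum>i=1..n1. int (\<alpha> i))
        + (\<Sum>i=1..n2. int (\<beta> i)) - (\<Sum>r=n2+1..n. int (\<beta> r)) = k'}"

end

theory Submission
  imports Defs "HOL-Real_Asymp.Real_Asymp"
begin

text \<open>
  Give the variables weights \<open>\<plusminus>1\<close> (\<open>-1\<close> for \<open>x\<^sub>i\<close>, \<open>i \<le> n1\<close>, and \<open>y\<^sub>i\<close>, \<open>i > n2\<close>; \<open>+1\<close> for the others), so
  that \<open>B_deg n n1 n2 k'\<close> is spanned by the monomials of weight \<open>k'\<close>. All nonzero finitely generated
  submodules of a weight space turn out to have the same dimension \<open>2n - 1\<close>
  (\<open>has_GK_dim_submodule_B_deg\<close>).

  Upper bound. The operators are quadratic in the \<open>x\<^sub>i\<close>, \<open>y\<^sub>i\<close> and the partial derivatives, so they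
  preserve the weight and raise the degree by at most 2. Hence \<open>U\<^sub>k M\<^sub>0\<close> lies in the span of the
  monomials of weight \<open>k'\<close> and degree at most \<open>N + 2k\<close>, for a constant \<open>N\<close>. The weight determines
  the exponent of \<open>x\<^sub>1\<close> from the other \<open>2n - 1\<close> exponents, which leaves at most
  \<open>(N + 2k + 1)\<^bsup>2n-1\<^esup>\<close> monomials.

  Lower bound. For each of the \<open>2n - 1\<close> variables \<open>z \<noteq> x\<^sub>1\<close> there is an element of \<open>sp n\<close> that acts as
  \<open>p \<mapsto> - \<mu>\<^sub>z p + \<dots>\<close>, where \<open>\<mu>\<^sub>z\<close> is a quadratic monomial and the omitted terms involve lower powers
  of \<open>x\<^sub>1\<close>. In a lexicographic order in which \<open>x\<^sub>1\<close> is dominant it therefore multiplies the leading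
  monomial of every nonzero \<open>p\<close> by \<open>\<mu>\<^sub>z\<close> (\<open>lead_mon_raising\<close>). The \<open>\<mu>\<^sub>z\<close> are multiplicatively
  independent, so words of length at most \<open>k\<close> in these elements, applied to a single
  \<open>f \<noteq> 0\<close> in \<open>M\<^sub>0\<close>, give at least \<open>(k div (2n - 1) + 1)\<^bsup>2n-1\<^esup>\<close> distinct leading monomials
  (\<open>dim_env_filt_ge\<close>). Both bounds together make \<open>ln (dim U\<^sub>k M\<^sub>0) / ln k\<close> converge to \<open>2n - 1\<close>.

  Finite generation. An irreducible module is generated by any of its nonzero vectors. For \<open>n1 = n2\<close>,
  write \<open>u\<^sub>i\<close> and \<open>v\<^sub>i\<close> for the variables of weight \<open>-1\<close> and \<open>+1\<close> with index \<open>i\<close>, up to a sign. The weight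
  space of 0 is the algebra generated by the products \<open>u\<^sub>i v\<^sub>j\<close>. The symmetric combinations
  \<open>s\<^sub>i\<^sub>j = u\<^sub>i v\<^sub>j + u\<^sub>j v\<^sub>i\<close> act as multiplication operators from \<open>sp n\<close>, up to scalars, and a product of two
  alternating ones \<open>u\<^sub>i v\<^sub>j - u\<^sub>j v\<^sub>i\<close> is a polynomial in the \<open>s\<^sub>i\<^sub>j\<close>. Hence 1 and the alternating
  combinations generate the weight space (\<open>B_deg_0_finitely_generated\<close>).
\<close>

section \<open>Filtrations generated by a Lie algebra action\<close>

locale lie_action = vector_space smul
  for smul :: "complex \<Rightarrow> 'b::ab_group_add \<Rightarrow> 'b" +
  fixes act :: "'g \<Rightarrow> 'b \<Rightarrow> 'b" and g :: "'g set"
  assumes act_linear: "a \<in> g \<Longrightarrow> Vector_Spaces.linear smul smul (act a)"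
begin

lemma env_filt_mono:
  assumes "k \<le> l" "M\<^sub>0 \<subseteq> M\<^sub>1"
  shows "env_filt smul act g k M\<^sub>0 \<subseteq> env_filt smul act g l M\<^sub>1"
  unfolding env_filt_def using assms by (intro span_mono) fastforce

lemma word_in_env_filt:
  assumes "set as \<subseteq> g" "length as \<le> k" "v \<in> M\<^sub>0"
  shows "foldr act as v \<in> env_filt smul act g k M\<^sub>0"
  unfolding env_filt_def using assms by (intro span_base) blast

lemma act_env_filt:
  assumes "a \<in> g" "v \<in> env_filt smul act g k M\<^sub>0"
  shows "act a v \<in> env_filt smul act g (Suc k) M\<^sub>0"
proof -
  interpret a: Vector_Spaces.linear smul smul "act a"
    using assms(1) by (rule act_linear)
  let ?S = "\<lambda>k. {foldr act as v | as v. set as \<subseteq> g \<and> length as \<le> k \<and> v \<in> M\<^sub>0}"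
  have "act a ` ?S k \<subseteq> ?S (Suc k)"
  proof clarify
    fix as v assume "set as \<subseteq> g" "length as \<le> k" "v \<in> M\<^sub>0"
    then show "\<exists>bs w. act a (foldr act as v) = foldr act bs w \<and> set bs \<subseteq> g \<and> length bs \<le> Suc k \<and> w \<in> M\<^sub>0"
      using assms(1) by (intro exI[of _ "a # as"] exI[of _ v]) auto
  qed
  then have "act a ` span (?S k) \<subseteq> span (?S (Suc k))"
    by (subst a.span_image[symmetric]) (rule span_mono)
  then show ?thesis using assms(2) unfolding env_filt_def by blast
qed

lemma subset_env_gen: "M\<^sub>0 \<subseteq> env_gen smul act g M\<^sub>0"
proof
  fix v assume "v \<in> M\<^sub>0"
  then have "foldr act [] v \<in> env_filt smul act g 0 M\<^sub>0" by (intro word_in_env_filt) auto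
  then show "v \<in> env_gen smul act g M\<^sub>0" by (auto simp: env_gen_def)
qed

lemma lie_submodule_env_gen: "lie_submodule smul act g (env_gen smul act g M\<^sub>0)"
proof -
  let ?F = "\<lambda>k. env_filt smul act g k M\<^sub>0"
  have sub: "subspace (?F k)" for k unfolding env_filt_def by (rule subspace_span)
  have "subspace (\<Union>k. ?F k)"
    unfolding subspace_def
  proof (intro conjI ballI allI)
    show "0 \<in> (\<Union>k. ?F k)" using subspace_0[OF sub] by blast
    fix x y assume "x \<in> (\<Union>k. ?F k)" "y \<in> (\<Union>k. ?F k)"
    then obtain k l where "x \<in> ?F k" "y \<in> ?F l" by blast
    then have "x \<in> ?F (max k l)" "y \<in> ?F (max k l)"
      using env_filt_mono[of k "max k l" M\<^sub>0 M\<^sub>0] env_filt_mono[of l "max k l" M\<^sub>0 M\<^sub>0] by auto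
    then show "x + y \<in> (\<Union>k. ?F k)" using subspace_add[OF sub] by blast
  next
    fix c x assume "x \<in> (\<Union>k. ?F k)"
    then show "smul c x \<in> (\<Union>k. ?F k)" using subspace_scale[OF sub] by blast
  qed
  then show ?thesis unfolding lie_submodule_def env_gen_def using act_env_filt by blast
qed

lemma env_gen_minimal:
  assumes N: "lie_submodule smul act g N" and "M\<^sub>0 \<subseteq> N"
  shows "env_gen smul act g M\<^sub>0 \<subseteq> N"
proof -
  have "foldr act as v \<in> N" if "set as \<subseteq> g" "v \<in> M\<^sub>0" for as v
    using that N \<open>M\<^sub>0 \<subseteq> N\<close> by (induction as) (auto simp: lie_submodule_def)
  then show ?thesis
    using N unfolding env_gen_def env_filt_def lie_submodule_def
    by (intro UN_least span_minimal) auto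
qed

lemma env_gen_span: "env_gen smul act g (span F) = env_gen smul act g F"
proof
  have "span F \<subseteq> env_gen smul act g F"
    using lie_submodule_env_gen[of F] subset_env_gen[of F]
    by (intro span_minimal) (auto simp: lie_submodule_def)
  then show "env_gen smul act g (span F) \<subseteq> env_gen smul act g F"
    by (intro env_gen_minimal lie_submodule_env_gen)
  show "env_gen smul act g F \<subseteq> env_gen smul act g (span F)"
    using subset_env_gen[of "span F"] span_superset[of F]
    by (intro env_gen_minimal lie_submodule_env_gen) auto
qed

lemma finitely_generated_env_gen:
  assumes "finite F"
  shows "\<exists>M\<^sub>0. fin_dim_subspace smul M\<^sub>0 \<and> env_gen smul act g M\<^sub>0 = env_gen smul act g F"
  using assms env_gen_span unfolding fin_dim_subspace_def by blast

text \<open>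
  The submodule generated by any nonzero vector is nonzero, so it is everything.
\<close>

lemma irreducible_finitely_generated:
  assumes "lie_irreducible smul act g M"
  shows "\<exists>M\<^sub>0. fin_dim_subspace smul M\<^sub>0 \<and> env_gen smul act g M\<^sub>0 = M"
proof -
  from assms have M: "lie_submodule smul act g M" "M \<noteq> {0}"
    by (auto simp: lie_irreducible_def)
  then obtain v where v: "v \<in> M" "v \<noteq> 0"
    using subspace_0 by (fastforce simp: lie_submodule_def)
  have "env_gen smul act g {v} \<subseteq> M" "env_gen smul act g {v} \<noteq> {0}"
    using v M env_gen_minimal[of M "{v}"] subset_env_gen[of "{v}"] by auto
  then have "env_gen smul act g {v} = M"
    using assms lie_submodule_env_gen by (auto simp: lie_irreducible_def)
  then show ?thesis using finitely_generated_env_gen[of "{v}"] by auto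
qed

end

text \<open>
  The finite spanning set excludes subspaces without a finite basis, whose \<open>dim\<close> is 0.
\<close>

lemma (in vector_space) card_independent_le_dim:
  assumes "independent S" "S \<subseteq> V" "V \<subseteq> span T" "finite T"
  shows "card S \<le> dim V"
proof -
  obtain B where B: "B \<subseteq> V" "independent B" "V \<subseteq> span B" "card B = dim V"
    using basis_exists by blast
  have "finite B" using independent_span_bound[of T B] assms B by auto
  then show ?thesis using independent_span_bound[of B S] assms B by auto
qed

section \<open>Coefficients of products and derivatives\<close>

lemma poly_mapping_sum_single:
  "p = (\<Sum>m\<in>Poly_Mapping.keys p. Poly_Mapping.single m (Poly_Mapping.lookup p m))"
  by (rule poly_mapping_eqI) (auto simp: lookup_sum lookup_single when_def sum.delta in_keys_iff)

lemma lookup_monomial_times: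
  fixes p :: "('a::cancel_comm_monoid_add) \<Rightarrow>\<^sub>0 ('b::comm_semiring_1)"
  shows "Poly_Mapping.lookup (Poly_Mapping.single u c * p) (u + m) = c * Poly_Mapping.lookup p m"
proof -
  have "Poly_Mapping.single u c * p =
      (\<Sum>m'\<in>Poly_Mapping.keys p. Poly_Mapping.single (u + m') (c * Poly_Mapping.lookup p m'))"
    by (subst poly_mapping_sum_single[of p]) (simp add: sum_distrib_left mult_single)
  then show ?thesis
    by (simp add: lookup_sum lookup_single when_def sum.delta in_keys_iff)
qed

lemma keys_monomial_times:
  fixes p :: "('a::cancel_comm_monoid_add) \<Rightarrow>\<^sub>0 ('b::comm_semiring_1)"
  assumes "m \<in> Poly_Mapping.keys (Poly_Mapping.single u c * p)"
  obtains m' where "m' \<in> Poly_Mapping.keys p" "m = u + m'"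
  using subsetD[OF keys_mult assms] by (auto split: if_splits)

text \<open>
  The coefficientwise form of the derivative makes its linearity and its effect on the monomials
  of a polynomial immediate. It holds because subtracting \<open>v\<close> from an exponent vector is injective
  on the monomials that contain \<open>v\<close>, while the other monomials have coefficient 0.
\<close>

lemma lookup_pdiff:
  "Poly_Mapping.lookup (pdiff v p) m =
     of_nat (Suc (Poly_Mapping.lookup m v)) * Poly_Mapping.lookup p (m + Poly_Mapping.single v 1)"
proof -
  have *: "(of_nat (Poly_Mapping.lookup m' v) * Poly_Mapping.lookup p m' when m' - Poly_Mapping.single v 1 = m)
      = (if m' = m + Poly_Mapping.single v 1
         then of_nat (Suc (Poly_Mapping.lookup m v)) * Poly_Mapping.lookup p (m + Poly_Mapping.single v 1)
         else 0)" for m'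
  proof (cases "m' = m + Poly_Mapping.single v 1")
    case False
    have "Poly_Mapping.lookup m' v = 0" if "m' - Poly_Mapping.single v 1 = m"
    proof (rule ccontr)
      assume "Poly_Mapping.lookup m' v \<noteq> 0"
      then have "m' = m + Poly_Mapping.single v 1"
        unfolding that[symmetric]
        by (intro poly_mapping_eqI) (auto simp: lookup_add lookup_minus lookup_single when_def)
      with False show False by simp
    qed
    with False show ?thesis by (auto simp: when_def)
  qed (simp add: lookup_add)
  have "Poly_Mapping.lookup (pdiff v p) m = (\<Sum>m'\<in>Poly_Mapping.keys p.
      of_nat (Poly_Mapping.lookup m' v) * Poly_Mapping.lookup p m' when m' - Poly_Mapping.single v 1 = m)"
    by (simp add: pdiff_def lookup_sum lookup_single)
  also have "\<dots> = of_nat (Suc (Poly_Mapping.lookup m v)) * Poly_Mapping.lookup p (m + Poly_Mapping.single v 1)"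
    unfolding * by (simp add: sum.delta in_keys_iff)
  finally show ?thesis .
qed

lemma keys_pdiff: "m \<in> Poly_Mapping.keys (pdiff v p) \<Longrightarrow> m + Poly_Mapping.single v 1 \<in> Poly_Mapping.keys p"
  by (auto simp: in_keys_iff lookup_pdiff)

lemma lookup_poly_scale: "Poly_Mapping.lookup (poly_scale c p) m = c * Poly_Mapping.lookup p m"
  using lookup_monomial_times[of 0 c p m] by (simp add: poly_scale_def)

lemma pdiff_add: "pdiff v (p + q) = pdiff v p + pdiff v q"
  by (rule poly_mapping_eqI) (simp add: lookup_pdiff lookup_add algebra_simps)

lemma pdiff_scale: "pdiff v (poly_scale c p) = poly_scale c (pdiff v p)"
  by (rule poly_mapping_eqI) (simp add: lookup_pdiff lookup_poly_scale)

lemma mult_scale: "q * poly_scale c p = poly_scale c (q * p)"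
  by (simp add: poly_scale_def algebra_simps)

lemma osc_linear: "Vector_Spaces.linear poly_scale poly_scale (osc n n1 n2 A)"
proof -
  have "Exx n1 i j (p + q) = Exx n1 i j p + Exx n1 i j q"
    "Eyy n2 i j (p + q) = Eyy n2 i j p + Eyy n2 i j q"
    "Eup n1 n2 i j (p + q) = Eup n1 n2 i j p + Eup n1 n2 i j q"
    "Elow n1 n2 i j (p + q) = Elow n1 n2 i j p + Elow n1 n2 i j q" for i j p q
    by (simp_all add: Exx_def Eyy_def Eup_def Elow_def pdiff_add algebra_simps)
  then have add: "osc n n1 n2 A (p + q) = osc n n1 n2 A p + osc n n1 n2 A q" for p q
    unfolding osc_def sum.distrib[symmetric]
    by (intro sum.cong refl)
      (simp add: cpoly.scale_right_distrib cpoly.scale_right_diff_distrib)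
  have "Exx n1 i j (poly_scale c p) = poly_scale c (Exx n1 i j p)"
    "Eyy n2 i j (poly_scale c p) = poly_scale c (Eyy n2 i j p)"
    "Eup n1 n2 i j (poly_scale c p) = poly_scale c (Eup n1 n2 i j p)"
    "Elow n1 n2 i j (poly_scale c p) = poly_scale c (Elow n1 n2 i j p)" for i j c p
    by (simp_all add: Exx_def Eyy_def Eup_def Elow_def pdiff_scale mult_scale
        cpoly.scale_right_diff_distrib)
  then have "osc n n1 n2 A (poly_scale c p) = poly_scale c (osc n n1 n2 A p)" for c p
    by (simp add: osc_def cpoly.scale_sum_right cpoly.scale_right_distrib
        cpoly.scale_right_diff_distrib mult.commute)
  with add show ?thesis
    by unfold_locales
qed

global_interpretation osc: lie_action poly_scale "osc n n1 n2" "sp n" for n n1 n2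
  by (intro lie_action.intro lie_action_axioms.intro cpoly.vector_space_axioms osc_linear)

section \<open>Weights, degrees and the upper bound\<close>

abbreviation pvar :: "var \<Rightarrow> cpoly" where
  "pvar v \<equiv> Poly_Mapping.single (Poly_Mapping.single v 1) 1"

definition vars :: "nat \<Rightarrow> var set" where
  "vars n = VX ` {1..n} \<union> VY ` {1..n}"

fun var_wt :: "nat \<Rightarrow> nat \<Rightarrow> var \<Rightarrow> int" where
  "var_wt n1 n2 (VX i) = (if i \<le> n1 then -1 else 1)"
| "var_wt n1 n2 (VY i) = (if i \<le> n2 then 1 else -1)"

definition mon_wt :: "nat \<Rightarrow> nat \<Rightarrow> nat \<Rightarrow> (var \<Rightarrow>\<^sub>0 nat) \<Rightarrow> int" where
  "mon_wt n n1 n2 m = (\<Sum>v\<in>vars n. var_wt n1 n2 v * int (Poly_Mapping.lookup m v))"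

definition mon_deg :: "nat \<Rightarrow> (var \<Rightarrow>\<^sub>0 nat) \<Rightarrow> nat" where
  "mon_deg n m = (\<Sum>v\<in>vars n. Poly_Mapping.lookup m v)"

definition wt_mons :: "nat \<Rightarrow> nat \<Rightarrow> nat \<Rightarrow> int \<Rightarrow> (var \<Rightarrow>\<^sub>0 nat) set" where
  "wt_mons n n1 n2 k = {m. Poly_Mapping.keys m \<subseteq> vars n \<and> mon_wt n n1 n2 m = k}"

definition wt_polys :: "nat \<Rightarrow> nat \<Rightarrow> nat \<Rightarrow> int \<Rightarrow> nat \<Rightarrow> cpoly set" where
  "wt_polys n n1 n2 k N =
     {p. Poly_Mapping.keys p \<subseteq> {m \<in> wt_mons n n1 n2 k. mon_deg n m \<le> N}}"

lemma finite_vars [simp]: "finite (vars n)"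
  by (simp add: vars_def)

lemma VX_vars [simp]: "VX i \<in> vars n \<longleftrightarrow> i \<in> {1..n}"
  and VY_vars [simp]: "VY i \<in> vars n \<longleftrightarrow> i \<in> {1..n}"
  by (auto simp: vars_def)

lemma card_vars: "card (vars n) = 2 * n"
proof -
  have "card (vars n) = card (VX ` {1..n}) + card (VY ` {1..n})"
    unfolding vars_def by (intro card_Un_disjoint) auto
  then show ?thesis by (simp add: card_image inj_on_def)
qed

lemma sum_vars: "(\<Sum>v\<in>vars n. f v) = (\<Sum>i=1..n. f (VX i)) + (\<Sum>i=1..n. f (VY i))"
proof -
  have "(\<Sum>v\<in>vars n. f v) = sum f (VX ` {1..n}) + sum f (VY ` {1..n})"
    unfolding vars_def by (intro sum.union_disjoint) auto
  then show ?thesis by (simp add: sum.reindex inj_on_def)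
qed

lemma mon_wt_add: "mon_wt n n1 n2 (m + m') = mon_wt n n1 n2 m + mon_wt n n1 n2 m'"
  by (simp add: mon_wt_def lookup_add algebra_simps sum.distrib)

lemma mon_deg_add: "mon_deg n (m + m') = mon_deg n m + mon_deg n m'"
  by (simp add: mon_deg_def lookup_add sum.distrib)

lemma mon_wt_var: "v \<in> vars n \<Longrightarrow> mon_wt n n1 n2 (Poly_Mapping.single v 1) = var_wt n1 n2 v"
  by (simp add: mon_wt_def lookup_single when_def if_distrib[of int] if_distrib[of "(*) _"] sum.delta' cong: if_cong)

lemma mon_deg_var: "v \<in> vars n \<Longrightarrow> mon_deg n (Poly_Mapping.single v 1) = 1"
  by (simp add: mon_deg_def lookup_single when_def sum.delta')

lemma subspace_wt_polys: "cpoly.subspace (wt_polys n n1 n2 k N)"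
  unfolding cpoly.subspace_def wt_polys_def
  by (auto simp: in_keys_iff lookup_poly_scale lookup_add subset_iff) (metis add.right_neutral lookup_add)+

lemma wt_polys_mono: "N \<le> N' \<Longrightarrow> wt_polys n n1 n2 k N \<subseteq> wt_polys n n1 n2 k N'"
  by (auto simp: wt_polys_def subset_iff)

lemma pvar_times_wt_polys:
  assumes "p \<in> wt_polys n n1 n2 k N" "v \<in> vars n"
  shows "pvar v * p \<in> wt_polys n n1 n2 (k + var_wt n1 n2 v) (Suc N)"
  unfolding wt_polys_def
proof (rule CollectI, rule subsetI)
  fix m assume "m \<in> Poly_Mapping.keys (pvar v * p)"
  then obtain m' where m': "m' \<in> Poly_Mapping.keys p" "m = Poly_Mapping.single v 1 + m'"
    by (rule keys_monomial_times)
  have "Poly_Mapping.keys m \<subseteq> insert v (Poly_Mapping.keys m')"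
    unfolding m' using keys_add[of "Poly_Mapping.single v 1" m'] by auto
  then show "m \<in> {m \<in> wt_mons n n1 n2 (k + var_wt n1 n2 v). mon_deg n m \<le> Suc N}"
    using assms m'
    by (auto simp: wt_polys_def wt_mons_def mon_wt_add mon_deg_add mon_wt_var mon_deg_var
        simp del: One_nat_def)
qed

lemma pdiff_wt_polys:
  assumes "p \<in> wt_polys n n1 n2 k N" "v \<in> vars n"
  shows "pdiff v p \<in> wt_polys n n1 n2 (k - var_wt n1 n2 v) (Suc N)"
  unfolding wt_polys_def
proof (rule CollectI, rule subsetI)
  fix m assume "m \<in> Poly_Mapping.keys (pdiff v p)"
  then have m': "m + Poly_Mapping.single v 1 \<in> Poly_Mapping.keys p" (is "?m' \<in> _")
    by (rule keys_pdiff)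
  have "Poly_Mapping.keys m \<subseteq> Poly_Mapping.keys ?m'"
    by (auto simp: in_keys_iff lookup_add)
  moreover have "?m' \<in> wt_mons n n1 n2 k" "mon_deg n ?m' \<le> N"
    using m' assms(1) by (auto simp: wt_polys_def)
  ultimately show "m \<in> {m \<in> wt_mons n n1 n2 (k - var_wt n1 n2 v). mon_deg n m \<le> Suc N}"
    using mon_wt_add[of n n1 n2 m "Poly_Mapping.single v 1"]
      mon_deg_add[of n m "Poly_Mapping.single v 1"] assms(2)
    by (auto simp: wt_mons_def mon_wt_var mon_deg_var simp del: One_nat_def)
qed

text \<open>
  The three shapes of quadratic operators that occur in the representation, each under the condition
  that makes it preserve the weight. A derivative subtracts the weight of its variable, and the degree bound is
  raised by 1 for every factor, derivatives included, so that one bound serves all three.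
\<close>

lemma quadratic_wt_polys:
  assumes "p \<in> wt_polys n n1 n2 k N" "u \<in> vars n" "v \<in> vars n"
  shows "var_wt n1 n2 u + var_wt n1 n2 v = 0 \<Longrightarrow> pvar u * (pvar v * p) \<in> wt_polys n n1 n2 k (Suc (Suc N))"
    and "var_wt n1 n2 u = var_wt n1 n2 v \<Longrightarrow> pvar u * pdiff v p \<in> wt_polys n n1 n2 k (Suc (Suc N))"
    and "var_wt n1 n2 u + var_wt n1 n2 v = 0 \<Longrightarrow> pdiff u (pdiff v p) \<in> wt_polys n n1 n2 k (Suc (Suc N))"
  using pvar_times_wt_polys[OF pvar_times_wt_polys[OF assms(1,3)] assms(2)]
    pvar_times_wt_polys[OF pdiff_wt_polys[OF assms(1,3)] assms(2)]
    pdiff_wt_polys[OF pdiff_wt_polys[OF assms(1,3)] assms(2)]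
  by (simp_all add: algebra_simps eq_neg_iff_add_eq_0[symmetric])

text \<open>
  Each case in the definitions of the operators pairs variables whose weights match one of
  the three shapes above.
\<close>

lemma osc_wt_polys:
  assumes p: "p \<in> wt_polys n n1 n2 k N"
  shows "osc n n1 n2 A p \<in> wt_polys n n1 n2 k (Suc (Suc N))"
proof -
  note sub = subspace_wt_polys[of n n1 n2 k "Suc (Suc N)"]
  have p': "p \<in> wt_polys n n1 n2 k (Suc (Suc N))"
    by (rule subsetD[OF wt_polys_mono p]) simp
  have "Exx n1 i j p \<in> wt_polys n n1 n2 k (Suc (Suc N))" "Eyy n2 i j p \<in> wt_polys n n1 n2 k (Suc (Suc N))"
    "Eup n1 n2 i j p \<in> wt_polys n n1 n2 k (Suc (Suc N))" "Elow n1 n2 i j p \<in> wt_polys n n1 n2 k (Suc (Suc N))"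
    if "i \<in> {1..n}" "j \<in> {1..n}" for i j
    using that p' cpoly.subspace_0[OF sub]
    by (auto simp: Exx_def Eyy_def Eup_def Elow_def xv_def yv_def mult.assoc
        intro!: cpoly.subspace_diff[OF sub] cpoly.subspace_neg[OF sub] quadratic_wt_polys[OF p]
        simp del: One_nat_def)
  then show ?thesis unfolding osc_def
    by (intro cpoly.subspace_sum[OF sub] cpoly.subspace_add[OF sub] cpoly.subspace_scale[OF sub]
        cpoly.subspace_diff[OF sub]) auto
qed

definition xy_mon :: "nat \<Rightarrow> (nat \<Rightarrow> nat) \<Rightarrow> (nat \<Rightarrow> nat) \<Rightarrow> (var \<Rightarrow>\<^sub>0 nat)" where
  "xy_mon n \<alpha> \<beta> = (\<Sum>i=1..n. Poly_Mapping.single (VX i) (\<alpha> i)) + (\<Sum>i=1..n. Poly_Mapping.single (VY i) (\<beta> i))"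

lemma lookup_xy_mon:
  "Poly_Mapping.lookup (xy_mon n \<alpha> \<beta>) (VX i) = (if i \<in> {1..n} then \<alpha> i else 0)"
  "Poly_Mapping.lookup (xy_mon n \<alpha> \<beta>) (VY i) = (if i \<in> {1..n} then \<beta> i else 0)"
  by (simp_all add: xy_mon_def lookup_add lookup_sum lookup_single when_def sum.delta)


lemma pvar_power: "pvar v ^ a = Poly_Mapping.single (Poly_Mapping.single v a) 1"
  by (induction a) (simp_all add: mult_single flip: single_add)

lemma prod_single: "finite I \<Longrightarrow> (\<Prod>i\<in>I. Poly_Mapping.single (f i) 1) = (Poly_Mapping.single (\<Sum>i\<in>I. f i) 1 :: cpoly)"
  by (induction I rule: finite_induct) (simp_all add: mult_single)

lemma xy_mon_prod:
  "(\<Prod>i=1..n. xv i ^ \<alpha> i) * (\<Prod>i=1..n. yv i ^ \<beta> i) = Poly_Mapping.single (xy_mon n \<alpha> \<beta>) 1"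
  by (simp add: xv_def yv_def pvar_power prod_single mult_single xy_mon_def del: One_nat_def)

lemma xy_mon_lookup:
  assumes "Poly_Mapping.keys m \<subseteq> vars n"
  shows "xy_mon n (\<lambda>i. Poly_Mapping.lookup m (VX i)) (\<lambda>i. Poly_Mapping.lookup m (VY i)) = m"
proof (rule poly_mapping_eqI)
  fix v
  have "v \<notin> vars n \<Longrightarrow> Poly_Mapping.lookup m v = 0"
    using assms by (auto simp: in_keys_iff)
  then show "Poly_Mapping.lookup (xy_mon n (\<lambda>i. Poly_Mapping.lookup m (VX i)) (\<lambda>i. Poly_Mapping.lookup m (VY i))) v
      = Poly_Mapping.lookup m v"
    by (cases v) (auto simp: lookup_xy_mon)
qed

lemma keys_xy_mon: "Poly_Mapping.keys (xy_mon n \<alpha> \<beta>) \<subseteq> vars n"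
proof
  fix v assume "v \<in> Poly_Mapping.keys (xy_mon n \<alpha> \<beta>)"
  then show "v \<in> vars n" by (cases v) (auto simp: in_keys_iff lookup_xy_mon split: if_splits)
qed

lemma signed_sum_split:
  fixes a n :: nat
  assumes "a \<le> n"
  shows "(\<Sum>i=1..n. (if i \<le> a then -1 else 1) * f i) = (\<Sum>i=a+1..n. f i) - (\<Sum>i=1..a. f i :: int)"
proof -
  have *: "{1..n} = {1..a} \<union> {a+1..n}" using assms by auto
  have "(\<Sum>i=1..n. (if i \<le> a then -1 else 1) * f i)
      = (\<Sum>i=1..a. (if i \<le> a then -1 else 1) * f i) + (\<Sum>i=a+1..n. (if i \<le> a then -1 else 1) * f i)"
    unfolding * by (rule sum.union_disjoint) auto
  then show ?thesis by (simp add: sum_negf)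
qed

lemma mon_wt_eq:
  assumes "n1 \<le> n" "n2 \<le> n"
  shows "mon_wt n n1 n2 m =
    (\<Sum>r=n1+1..n. int (Poly_Mapping.lookup m (VX r))) - (\<Sum>i=1..n1. int (Poly_Mapping.lookup m (VX i)))
    + (\<Sum>i=1..n2. int (Poly_Mapping.lookup m (VY i))) - (\<Sum>r=n2+1..n. int (Poly_Mapping.lookup m (VY r)))"
proof -
  have "(\<Sum>i=1..n. (if i \<le> n2 then 1 else -1) * int (Poly_Mapping.lookup m (VY i)))
      = - (\<Sum>i=1..n. (if i \<le> n2 then -1 else 1) * int (Poly_Mapping.lookup m (VY i)))"
    unfolding sum_negf[symmetric] by (rule sum.cong) auto
  then show ?thesis
    unfolding mon_wt_def sum_vars var_wt.simps signed_sum_split[OF assms(1)]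
    using signed_sum_split[OF assms(2), of "\<lambda>i. int (Poly_Mapping.lookup m (VY i))"] by simp
qed

text \<open>
  Turns the weight condition on the pair \<open>(\<alpha>, \<beta>)\<close> of exponent functions into one on exponent
  vectors supported on \<open>vars n\<close>.
\<close>

lemma B_deg_span:
  assumes "n1 \<le> n" "n2 \<le> n"
  shows "B_deg n n1 n2 k = cpoly.span ((\<lambda>m. Poly_Mapping.single m 1) ` wt_mons n n1 n2 k)"
proof -
  have "{(\<Prod>i=1..n. xv i ^ \<alpha> i) * (\<Prod>i=1..n. yv i ^ \<beta> i) | \<alpha> \<beta> :: nat \<Rightarrow> nat.
        (\<Sum>r=n1+1..n. int (\<alpha> r)) - (\<Sum>i=1..n1. int (\<alpha> i))
        + (\<Sum>i=1..n2. int (\<beta> i)) - (\<Sum>r=n2+1..n. int (\<beta> r)) = k}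
      = (\<lambda>m. Poly_Mapping.single m 1) ` wt_mons n n1 n2 k" (is "?L = ?R")
  proof (intro equalityI subsetI)
    fix p assume "p \<in> ?L"
    then obtain \<alpha> \<beta> where p: "p = Poly_Mapping.single (xy_mon n \<alpha> \<beta>) 1"
      and k: "(\<Sum>r=n1+1..n. int (\<alpha> r)) - (\<Sum>i=1..n1. int (\<alpha> i))
        + (\<Sum>i=1..n2. int (\<beta> i)) - (\<Sum>r=n2+1..n. int (\<beta> r)) = k"
      unfolding xy_mon_prod by blast
    have "(\<Sum>r=n1+1..n. int (Poly_Mapping.lookup (xy_mon n \<alpha> \<beta>) (VX r))) = (\<Sum>r=n1+1..n. int (\<alpha> r))"
      "(\<Sum>r=1..n1. int (Poly_Mapping.lookup (xy_mon n \<alpha> \<beta>) (VX r))) = (\<Sum>r=1..n1. int (\<alpha> r))"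
      "(\<Sum>r=n2+1..n. int (Poly_Mapping.lookup (xy_mon n \<alpha> \<beta>) (VY r))) = (\<Sum>r=n2+1..n. int (\<beta> r))"
      "(\<Sum>r=1..n2. int (Poly_Mapping.lookup (xy_mon n \<alpha> \<beta>) (VY r))) = (\<Sum>r=1..n2. int (\<beta> r))"
      using assms by (auto intro!: sum.cong simp: lookup_xy_mon)
    then have "xy_mon n \<alpha> \<beta> \<in> wt_mons n n1 n2 k"
      using k keys_xy_mon by (simp add: wt_mons_def mon_wt_eq[OF assms])
    then show "p \<in> ?R" unfolding p by blast
  next
    fix p assume "p \<in> ?R"
    then obtain m where m: "m \<in> wt_mons n n1 n2 k" "p = Poly_Mapping.single m 1" by blast
    then show "p \<in> ?L" unfolding xy_mon_prod
      by (intro CollectI exI[of _ "\<lambda>i. Poly_Mapping.lookup m (VX i)"] exI[of _ "\<lambda>i. Poly_Mapping.lookup m (VY i)"])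
        (auto simp: wt_mons_def mon_wt_eq[OF assms] xy_mon_lookup)
  qed
  then show ?thesis unfolding B_deg_def by simp
qed

lemma span_monomials:
  "cpoly.span ((\<lambda>m. Poly_Mapping.single m 1) ` X) = {p. Poly_Mapping.keys p \<subseteq> X}"
proof
  have "cpoly.subspace {p. Poly_Mapping.keys p \<subseteq> X}"
    unfolding cpoly.subspace_def
    by (auto simp: in_keys_iff lookup_poly_scale lookup_add subset_iff) (metis add.right_neutral)
  then show "cpoly.span ((\<lambda>m. Poly_Mapping.single m 1) ` X) \<subseteq> {p. Poly_Mapping.keys p \<subseteq> X}"
    by (intro cpoly.span_minimal) auto
  show "{p. Poly_Mapping.keys p \<subseteq> X} \<subseteq> cpoly.span ((\<lambda>m. Poly_Mapping.single m 1) ` X)"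
  proof clarify
    fix p :: cpoly assume "Poly_Mapping.keys p \<subseteq> X"
    then have "(\<Sum>m\<in>Poly_Mapping.keys p. poly_scale (Poly_Mapping.lookup p m) (Poly_Mapping.single m 1))
        \<in> cpoly.span ((\<lambda>m. Poly_Mapping.single m 1) ` X)"
      by (intro cpoly.span_sum cpoly.span_scale cpoly.span_base) auto
    then show "p \<in> cpoly.span ((\<lambda>m. Poly_Mapping.single m 1) ` X)"
      by (simp add: poly_scale_def mult_single flip: poly_mapping_sum_single)
  qed
qed

lemma B_deg_keys:
  assumes "n1 \<le> n" "n2 \<le> n"
  shows "B_deg n n1 n2 k = {p. Poly_Mapping.keys p \<subseteq> wt_mons n n1 n2 k}"
  by (simp add: B_deg_span assms span_monomials)

lemma finite_subset_wt_polys: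
  assumes "n1 \<le> n" "n2 \<le> n" "finite F" "F \<subseteq> B_deg n n1 n2 k"
  obtains N where "F \<subseteq> wt_polys n n1 n2 k N"
proof -
  have "finite (\<Union>p\<in>F. mon_deg n ` Poly_Mapping.keys p)" using assms(3) by simp
  then obtain N where N: "\<forall>d \<in> (\<Union>p\<in>F. mon_deg n ` Poly_Mapping.keys p). d \<le> N"
    using finite_nat_set_iff_bounded_le by blast
  then have "F \<subseteq> wt_polys n n1 n2 k N"
    using assms(4) by (fastforce simp: B_deg_keys[OF assms(1,2)] wt_polys_def)
  then show thesis by (rule that)
qed

lemma lie_submodule_B_deg:
  assumes "n1 \<le> n" "n2 \<le> n"
  shows "lie_submodule poly_scale (osc n n1 n2) (sp n) (B_deg n n1 n2 k)"
  unfolding lie_submodule_def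
proof (intro conjI ballI)
  show "cpoly.subspace (B_deg n n1 n2 k)" unfolding B_deg_def by (rule cpoly.subspace_span)
  fix A p assume "p \<in> B_deg n n1 n2 k"
  then obtain N where "p \<in> wt_polys n n1 n2 k N"
    using finite_subset_wt_polys[OF assms, of "{p}" k] by blast
  then show "osc n n1 n2 A p \<in> B_deg n n1 n2 k"
    using osc_wt_polys[of p n n1 n2 k N A] unfolding wt_polys_def B_deg_keys[OF assms] by blast
qed

lemma env_filt_wt_polys:
  assumes "M\<^sub>0 \<subseteq> wt_polys n n1 n2 k N"
  shows "env_filt poly_scale (osc n n1 n2) (sp n) l M\<^sub>0 \<subseteq> wt_polys n n1 n2 k (N + 2 * l)"
proof -
  have "foldr (osc n n1 n2) as v \<in> wt_polys n n1 n2 k (N + 2 * length as)" if "v \<in> M\<^sub>0" for as v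
  proof (induction as)
    case (Cons a as)
    then show ?case using osc_wt_polys[OF Cons, of a] by (simp add: algebra_simps)
  qed (use that assms in auto)
  then have "foldr (osc n n1 n2) as v \<in> wt_polys n n1 n2 k (N + 2 * l)"
    if "v \<in> M\<^sub>0" "length as \<le> l" for v as
    using subsetD[OF wt_polys_mono, of "N + 2 * length as" "N + 2 * l"] that by simp
  then show ?thesis unfolding env_filt_def
    by (intro cpoly.span_minimal subspace_wt_polys) auto
qed

text \<open>
  A monomial of given weight is determined by its exponents at the variables other than \<open>x\<^sub>1\<close>, since \<open>x\<^sub>1\<close> has
  nonzero weight. This is where one of the \<open>2n\<close> degrees of freedom is lost.
\<close>

lemma wt_mons_bounded:
  fixes n n1 n2 :: nat
  assumes "1 \<le> n"
  defines "X \<equiv> \<lambda>k N. {m \<in> wt_mons n n1 n2 k. mon_deg n m \<le> N}"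
  shows "finite (X k N)" and "card (X k N) \<le> (N + 1) ^ (2 * n - 1)"
proof -
  let ?V = "vars n - {VX 1}"
  let ?r = "\<lambda>m. restrict (Poly_Mapping.lookup m) ?V"
  have "inj_on ?r (X k N)"
  proof (rule inj_onI)
    fix m m' assume m: "m \<in> X k N" and m': "m' \<in> X k N" and eq: "?r m = ?r m'"
    have V: "Poly_Mapping.lookup m v = Poly_Mapping.lookup m' v" if "v \<in> ?V" for v
      using fun_cong[OF eq, of v] that by simp
    have "mon_wt n n1 n2 m = mon_wt n n1 n2 m'" using m m' by (simp add: X_def wt_mons_def)
    then have "var_wt n1 n2 (VX 1) * int (Poly_Mapping.lookup m (VX 1))
        = var_wt n1 n2 (VX 1) * int (Poly_Mapping.lookup m' (VX 1))"
      using \<open>1 \<le> n\<close> V by (simp add: mon_wt_def sum.remove[of "vars n" "VX 1"] del: One_nat_def)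
    then have x1: "Poly_Mapping.lookup m (VX 1) = Poly_Mapping.lookup m' (VX 1)"
      by (simp split: if_splits)
    \<comment> \<open>Variables outside \<open>vars n\<close> have exponent 0 in both monomials.\<close>
    show "m = m'"
    proof (rule poly_mapping_eqI)
      fix v
      consider "v = VX 1" | "v \<in> ?V" | "v \<notin> vars n" by blast
      then show "Poly_Mapping.lookup m v = Poly_Mapping.lookup m' v"
      proof cases
        case 3
        then have "v \<notin> Poly_Mapping.keys m" "v \<notin> Poly_Mapping.keys m'"
          using m m' by (auto simp: X_def wt_mons_def)
        then show ?thesis by (simp add: in_keys_iff)
      qed (use x1 V in auto)
    qed
  qed
  moreover have "?r ` X k N \<subseteq> PiE ?V (\<lambda>_. {..N})"
  proof clarify
    fix m assume "m \<in> X k N"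
    then have "Poly_Mapping.lookup m v \<le> N" if "v \<in> vars n" for v
      using member_le_sum[OF that, of "Poly_Mapping.lookup m"] by (simp add: X_def mon_deg_def)
    then show "?r m \<in> PiE ?V (\<lambda>_. {..N})" by auto
  qed
  moreover have "finite (PiE ?V (\<lambda>_. {..N}))" by (intro finite_PiE) auto
  moreover have "card (PiE ?V (\<lambda>_. {..N})) = (N + 1) ^ (2 * n - 1)"
    using \<open>1 \<le> n\<close> by (simp add: card_PiE card_vars)
  ultimately show "finite (X k N)" "card (X k N) \<le> (N + 1) ^ (2 * n - 1)"
    by (metis inj_on_finite, metis card_inj_on_le)
qed

lemma wt_polys_finite_span:
  assumes "1 \<le> n"
  obtains S where "finite S" "card S \<le> (N + 1) ^ (2 * n - 1)" "wt_polys n n1 n2 k N \<subseteq> cpoly.span S"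
proof -
  let ?X = "{m \<in> wt_mons n n1 n2 k. mon_deg n m \<le> N}"
  let ?S = "(\<lambda>m. Poly_Mapping.single m (1::complex)) ` ?X"
  have "card ?S \<le> card ?X" using wt_mons_bounded[OF assms] by (intro card_image_le)
  also have "\<dots> \<le> (N + 1) ^ (2 * n - 1)" by (rule wt_mons_bounded[OF assms])
  finally have "card ?S \<le> (N + 1) ^ (2 * n - 1)" .
  moreover have "finite ?S" using wt_mons_bounded[OF assms] by (intro finite_imageI)
  moreover have "wt_polys n n1 n2 k N \<subseteq> cpoly.span ?S"
    by (simp add: span_monomials wt_polys_def)
  ultimately show thesis using that by blast
qed

section \<open>Leading monomials and the lower bound\<close>

text \<open>
  A linear order on the variables in which \<open>x\<^sub>1\<close> comes first. The induced order on exponent vectors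
  is lexicographic, so of two monomials with different powers of \<open>x\<^sub>1\<close> the one with the higher power is the larger.
\<close>

fun var_rank :: "var \<Rightarrow> nat" where
  "var_rank (VX i) = (if i = 1 then 0 else 2 * i + 2)"
| "var_rank (VY i) = 2 * i + 1"

lemma inj_var_rank: "var_rank u = var_rank v \<Longrightarrow> u = v"
  by (cases u; cases v) (auto split: if_splits, presburger+)

instantiation var :: linorder
begin

definition less_eq_var :: "var \<Rightarrow> var \<Rightarrow> bool" where
  "u \<le> v \<longleftrightarrow> var_rank u \<le> var_rank v"

definition less_var :: "var \<Rightarrow> var \<Rightarrow> bool" where
  "u < v \<longleftrightarrow> var_rank u < var_rank v"

instance
  by standard (auto simp: less_eq_var_def less_var_def intro: inj_var_rank)

end

lemma mon_less_if_x1_less: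
  assumes "Poly_Mapping.lookup m (VX 1) < Poly_Mapping.lookup m' (VX 1)"
  shows "m < (m' :: var \<Rightarrow>\<^sub>0 nat)"
proof -
  have "\<not> u < VX 1" for u by (simp add: less_var_def)
  then have "less_fun (Poly_Mapping.lookup m) (Poly_Mapping.lookup m')"
    using assms unfolding less_fun_def by blast
  then show ?thesis by (simp add: less_poly_mapping.rep_eq)
qed

definition lead_mon :: "cpoly \<Rightarrow> (var \<Rightarrow>\<^sub>0 nat)" where
  "lead_mon p = Max (Poly_Mapping.keys p)"

lemma lead_mon_in_keys: "p \<noteq> 0 \<Longrightarrow> lead_mon p \<in> Poly_Mapping.keys p"
  unfolding lead_mon_def by (intro Max_in) auto

lemma le_lead_mon: "m \<in> Poly_Mapping.keys p \<Longrightarrow> m \<le> lead_mon p"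
  unfolding lead_mon_def by (intro Max_ge) auto

text \<open>
  Multiplication by a monomial shifts the leading monomial, and a perturbation \<open>q\<close> whose powers
  of \<open>x\<^sub>1\<close> stay below those of \<open>u * p\<close> cannot interfere with it.
\<close>

lemma lead_mon_perturbed_monomial_times:
  fixes u :: "var \<Rightarrow>\<^sub>0 nat"
  assumes "p \<noteq> 0"
    and Q: "\<And>m. m \<in> Poly_Mapping.keys q \<Longrightarrow>
      \<exists>m'\<in>Poly_Mapping.keys p. Poly_Mapping.lookup m (VX 1) < Poly_Mapping.lookup (u + m') (VX 1)"
  shows "q - Poly_Mapping.single u 1 * p \<noteq> 0 \<and>
    lead_mon (q - Poly_Mapping.single u 1 * p) = u + lead_mon p"
proof -
  let ?r = "q - Poly_Mapping.single u 1 * p"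
  have small: "m < u + lead_mon p" if m: "m \<in> Poly_Mapping.keys q" for m
  proof -
    obtain m' where m': "m' \<in> Poly_Mapping.keys p"
      "Poly_Mapping.lookup m (VX 1) < Poly_Mapping.lookup (u + m') (VX 1)" using Q[OF m] by blast
    from m'(2) have "m < u + m'" by (rule mon_less_if_x1_less)
    also have "\<dots> \<le> u + lead_mon p" using le_lead_mon[OF m'(1)] by (rule add_left_mono)
    finally show ?thesis .
  qed
  have "u + lead_mon p \<notin> Poly_Mapping.keys q" using small by blast
  then have top: "u + lead_mon p \<in> Poly_Mapping.keys ?r"
    using lead_mon_in_keys[OF \<open>p \<noteq> 0\<close>] by (simp add: in_keys_iff lookup_minus lookup_monomial_times)
  have "m \<le> u + lead_mon p" if "m \<in> Poly_Mapping.keys ?r" for m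
  proof (cases "m \<in> Poly_Mapping.keys q")
    case False
    then have "m \<in> Poly_Mapping.keys (Poly_Mapping.single u 1 * p)"
      using that by (auto simp: in_keys_iff lookup_minus)
    then obtain m' where "m' \<in> Poly_Mapping.keys p" "m = u + m'" by (rule keys_monomial_times)
    then show ?thesis using le_lead_mon by (simp add: add_left_mono)
  qed (use small in \<open>auto intro: less_imp_le\<close>)
  then have "lead_mon ?r = u + lead_mon p"
    unfolding lead_mon_def[of ?r] using top by (intro Max_eqI) auto
  then show ?thesis using top by auto
qed

text \<open>
  Adding the polynomials in increasing order of leading monomial, each new leading monomial occurs in
  no element of the span of the previous ones.
\<close>

lemma independent_if_lead_mons_distinct:
  assumes "finite S" "0 \<notin> S" "inj_on lead_mon S"
  shows "cpoly.independent S"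
  using assms
proof (induction S rule: finite_ranking_induct[where f = lead_mon])
  case (insert p S)
  show ?case
  proof (cases "p \<in> S")
    case False
    have "Poly_Mapping.keys q \<subseteq> {m. m \<noteq> lead_mon p}" if "q \<in> S" for q
    proof
      fix m assume "m \<in> Poly_Mapping.keys q"
      moreover have "lead_mon q \<noteq> lead_mon p"
        using insert.prems that False by (auto simp: inj_on_def)
      ultimately show "m \<in> {m. m \<noteq> lead_mon p}"
        using le_lead_mon[of m q] insert.hyps(2)[OF that] by auto
    qed
    then have "cpoly.span S \<subseteq> cpoly.span ((\<lambda>m. Poly_Mapping.single m 1) ` {m. m \<noteq> lead_mon p})"
      by (intro cpoly.span_minimal cpoly.subspace_span) (auto simp: span_monomials)
    then have "cpoly.span S \<subseteq> {q. Poly_Mapping.keys q \<subseteq> {m. m \<noteq> lead_mon p}}"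
      by (simp add: span_monomials)
    moreover have "lead_mon p \<in> Poly_Mapping.keys p"
      using insert.prems by (intro lead_mon_in_keys) auto
    ultimately have "p \<notin> cpoly.span S" by blast
    then show ?thesis using insert by (intro cpoly.independent_insertI) auto
  qed (use insert in \<open>simp add: insert_absorb\<close>)
qed (rule cpoly.independent_empty)

abbreviation mon2 :: "var \<Rightarrow> var \<Rightarrow> (var \<Rightarrow>\<^sub>0 nat)" where
  "mon2 u v \<equiv> Poly_Mapping.single u 1 + Poly_Mapping.single v 1"

text \<open>
  For each variable \<open>z \<noteq> x\<^sub>1\<close>, \<open>raising_elt\<close> is an element of \<open>sp n\<close> whose operator has
  \<open>- raising_mon z\<close> as its dominant multiplication term. If \<open>z\<close> has weight \<open>+1\<close>, this monomial is \<open>x\<^sub>1 z\<close>. If \<open>z\<close> has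
  weight \<open>-1\<close>, as \<open>x\<^sub>1\<close> does, then \<open>x\<^sub>1 z\<close> has weight \<open>-2\<close>, and the product \<open>x\<^sub>j y\<^sub>j\<close> of the two variables
  with the same index as \<open>z\<close> is used instead.
\<close>

fun raising_elt :: "nat \<Rightarrow> nat \<Rightarrow> nat \<Rightarrow> var \<Rightarrow> cmat" where
  "raising_elt n n1 n2 (VX j) =
     (if j \<le> n1 then Emat (n + j) j else Emat j 1 - Emat (n + 1) (n + j))"
| "raising_elt n n1 n2 (VY j) =
     (if n2 < j then Emat j (n + j)
      else if j = 1 then Emat (n + 1) 1 else Emat (n + 1) j + Emat (n + j) 1)"

fun raising_mon :: "nat \<Rightarrow> nat \<Rightarrow> var \<Rightarrow> (var \<Rightarrow>\<^sub>0 nat)" where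
  "raising_mon n1 n2 (VX j) = (if j \<le> n1 then mon2 (VX j) (VY j) else mon2 (VX 1) (VX j))"
| "raising_mon n1 n2 (VY j) = (if n2 < j then mon2 (VX j) (VY j) else mon2 (VX 1) (VY j))"

lemma raising_elt_in_sp:
  assumes "1 \<le> n1" "n1 \<le> n2" "n2 \<le> n" "z \<in> vars n - {VX 1}"
  shows "raising_elt n n1 n2 z \<in> sp n"
proof (cases z)
  case (VX j)
  then have j: "j \<in> {1..n}" "1 \<in> {1..n}" using assms by auto
  then have "Emat (n + j) j \<in> sp n" "Emat j 1 - Emat (n + 1) (n + j) \<in> sp n"
    unfolding sp_def by (intro cmat.span_base; blast)+
  then show ?thesis unfolding VX by simp
next
  case (VY j)
  then have j: "j \<in> {1..n}" "1 \<in> {1..n}" using assms by auto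
  then have "Emat j (n + j) \<in> sp n" "Emat (n + 1) 1 \<in> sp n"
    unfolding sp_def by (intro cmat.span_base; blast)+
  moreover have "Emat (n + 1) j + Emat (n + j) 1 \<in> sp n" if "j \<noteq> 1"
  proof -
    have "1 \<le> (1::nat)" "1 < j" "j \<le> n" using j that by auto
    then show ?thesis unfolding sp_def by (intro cmat.span_base) blast
  qed
  ultimately show ?thesis unfolding VY by simp
qed

lemma mon2_times: "pvar u * (pvar v * p) = Poly_Mapping.single (mon2 u v) 1 * p"
  by (simp add: mult_single flip: mult.assoc)

text \<open>
  In each case the operator is \<open>q - \<mu> p\<close>, where \<open>\<mu>\<close> is the raising monomial. When \<open>\<mu> = x\<^sub>j y\<^sub>j\<close>, \<open>q = 0\<close>. Otherwise \<open>\<mu>\<close>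
  contains \<open>x\<^sub>1\<close>, whereas \<open>q\<close> is 0 or arises from \<open>p\<close> by multiplications and derivatives with respect to other
  variables, so that it has strictly smaller powers of \<open>x\<^sub>1\<close>.
\<close>

lemma lead_mon_raising:
  assumes n: "1 \<le> n1" "n1 \<le> n2" "n2 \<le> n" and z: "z \<in> vars n - {VX 1}" and p: "p \<noteq> 0"
  shows "osc n n1 n2 (raising_elt n n1 n2 z) p \<noteq> 0 \<and>
    lead_mon (osc n n1 n2 (raising_elt n n1 n2 z) p) = raising_mon n1 n2 z + lead_mon p"
proof -
  have x1: "1 \<in> {1..n}" using n by auto
  have "\<exists>q. osc n n1 n2 (raising_elt n n1 n2 z) p = q - Poly_Mapping.single (raising_mon n1 n2 z) 1 * p
    \<and> (\<forall>m\<in>Poly_Mapping.keys q. \<exists>m'\<in>Poly_Mapping.keys p.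
        Poly_Mapping.lookup m (VX 1) < Poly_Mapping.lookup (raising_mon n1 n2 z + m') (VX 1))"
  proof (cases z)
    case (VX j)
    then have j: "j \<in> {1..n}" "j \<noteq> 1" using z by auto
    consider "j \<le> n1" | "n1 < j" "j \<le> n2" | "n2 < j" using n by linarith
    then show ?thesis
    proof cases
      case 1
      then show ?thesis unfolding VX using osc_E_low[OF j(1) j(1), of n1 n2 p] n
        by (intro exI[of _ 0]) (simp add: Elow_def xv_def yv_def mon2_times mult.assoc del: One_nat_def)
    next
      case 2
      have "osc n n1 n2 (raising_elt n n1 n2 z) p
        = - (pvar (VY 1) * pdiff (VY j) p) - Poly_Mapping.single (raising_mon n1 n2 z) 1 * p"
        unfolding VX using osc_E_diag[OF j(1) x1, of n1 n2 p] n 2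
        by (simp add: Exx_def Eyy_def xv_def yv_def mon2_times mult.assoc add.commute del: One_nat_def)
      moreover have "\<exists>m'\<in>Poly_Mapping.keys p.
        Poly_Mapping.lookup m (VX 1) < Poly_Mapping.lookup (raising_mon n1 n2 z + m') (VX 1)"
        if "m \<in> Poly_Mapping.keys (- (pvar (VY 1) * pdiff (VY j) p))" for m
      proof -
        from that have "m \<in> Poly_Mapping.keys (pvar (VY 1) * pdiff (VY j) p)" by (simp add: in_keys_iff)
        then obtain m'' where m'': "m'' \<in> Poly_Mapping.keys (pdiff (VY j) p)"
          "m = Poly_Mapping.single (VY 1) 1 + m''" by (rule keys_monomial_times)
        then show ?thesis
          unfolding VX using keys_pdiff[OF m''(1)] 2
          by (intro bexI[of _ "m'' + Poly_Mapping.single (VY j) 1"]) (simp_all add: lookup_add lookup_single)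
      qed
      ultimately show ?thesis by blast
    next
      case 3
      have "osc n n1 n2 (raising_elt n n1 n2 z) p
        = pvar (VY 1) * (pvar (VY j) * p) - Poly_Mapping.single (raising_mon n1 n2 z) 1 * p"
        unfolding VX using osc_E_diag[OF j(1) x1, of n1 n2 p] n 3
        by (simp add: Exx_def Eyy_def xv_def yv_def mon2_times mult.assoc add.commute del: One_nat_def)
      moreover have "\<exists>m'\<in>Poly_Mapping.keys p.
        Poly_Mapping.lookup m (VX 1) < Poly_Mapping.lookup (raising_mon n1 n2 z + m') (VX 1)"
        if "m \<in> Poly_Mapping.keys (pvar (VY 1) * (pvar (VY j) * p))" for m
      proof -
        from that obtain m' where m': "m' \<in> Poly_Mapping.keys p" "m = mon2 (VY 1) (VY j) + m'"
          unfolding mon2_times by (rule keys_monomial_times)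
        then show ?thesis
          unfolding VX using 3 n by (intro bexI[of _ m']) (simp_all add: lookup_add lookup_single)
      qed
      ultimately show ?thesis by blast
    qed
  next
    case (VY j)
    then have j: "j \<in> {1..n}" using z by auto
    consider "n2 < j" | "j = 1" | "j \<noteq> 1" "j \<le> n1" | "n1 < j" "j \<le> n2" using n by linarith
    then show ?thesis
    proof cases
      case 1
      then show ?thesis unfolding VY using osc_E_up[OF j j, of n1 n2 p] n
        by (intro exI[of _ 0]) (simp add: Eup_def xv_def yv_def mon2_times mult.assoc del: One_nat_def)
    next
      case 2
      then show ?thesis unfolding VY using osc_E_low[OF x1 x1, of n1 n2 p] n
        by (intro exI[of _ 0]) (simp add: Elow_def xv_def yv_def mon2_times mult.assoc del: One_nat_def)
    next
      case 3
      have "osc n n1 n2 (raising_elt n n1 n2 z) p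
        = - (pvar (VX j) * (pvar (VY 1) * p)) - Poly_Mapping.single (raising_mon n1 n2 z) 1 * p"
        unfolding VY using osc_E_low[OF j x1, of n1 n2 p] osc_E_low[OF x1 j, of n1 n2 p] n 3
        by (simp add: Elow_def xv_def yv_def mon2_times mult.assoc osc_add del: One_nat_def)
      moreover have "\<exists>m'\<in>Poly_Mapping.keys p.
        Poly_Mapping.lookup m (VX 1) < Poly_Mapping.lookup (raising_mon n1 n2 z + m') (VX 1)"
        if "m \<in> Poly_Mapping.keys (- (pvar (VX j) * (pvar (VY 1) * p)))" for m
      proof -
        from that have "m \<in> Poly_Mapping.keys (Poly_Mapping.single (mon2 (VX j) (VY 1)) 1 * p)"
          by (simp add: in_keys_iff mon2_times del: One_nat_def)
        then obtain m' where m': "m' \<in> Poly_Mapping.keys p" "m = mon2 (VX j) (VY 1) + m'"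
          by (rule keys_monomial_times)
        then show ?thesis
          unfolding VY using 3 n by (intro bexI[of _ m']) (simp_all add: lookup_add lookup_single)
      qed
      ultimately show ?thesis by blast
    next
      case 4
      have "osc n n1 n2 (raising_elt n n1 n2 z) p
        = pvar (VY 1) * pdiff (VX j) p - Poly_Mapping.single (raising_mon n1 n2 z) 1 * p"
        unfolding VY using osc_E_low[OF j x1, of n1 n2 p] osc_E_low[OF x1 j, of n1 n2 p] n 4
        by (simp add: Elow_def xv_def yv_def mon2_times mult.assoc osc_add del: One_nat_def)
      moreover have "\<exists>m'\<in>Poly_Mapping.keys p.
        Poly_Mapping.lookup m (VX 1) < Poly_Mapping.lookup (raising_mon n1 n2 z + m') (VX 1)"
        if "m \<in> Poly_Mapping.keys (pvar (VY 1) * pdiff (VX j) p)" for m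
      proof -
        from that obtain m'' where m'': "m'' \<in> Poly_Mapping.keys (pdiff (VX j) p)"
          "m = Poly_Mapping.single (VY 1) 1 + m''" by (rule keys_monomial_times)
        then show ?thesis
          unfolding VY using keys_pdiff[OF m''(1)] 4 n
          by (intro bexI[of _ "m'' + Poly_Mapping.single (VX j) 1"]) (simp_all add: lookup_add lookup_single)
      qed
      ultimately show ?thesis by blast
    qed
  qed
  then show ?thesis using lead_mon_perturbed_monomial_times[OF p] by metis
qed

lemma lead_mon_raising_word:
  assumes n: "1 \<le> n1" "n1 \<le> n2" "n2 \<le> n" and zs: "set zs \<subseteq> vars n - {VX 1}" and p: "p \<noteq> 0"
  shows "foldr (osc n n1 n2) (map (raising_elt n n1 n2) zs) p \<noteq> 0 \<and>
    lead_mon (foldr (osc n n1 n2) (map (raising_elt n n1 n2) zs) p)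
      = sum_list (map (raising_mon n1 n2) zs) + lead_mon p"
  using zs
proof (induction zs)
  case (Cons z zs)
  then have "z \<in> vars n - {VX 1}" by auto
  from lead_mon_raising[OF n this] Cons show ?case by (simp add: add.assoc)
qed (use p in simp)

lemma lookup_sum_list_raising:
  assumes "set zs \<subseteq> vars n - {VX 1}"
  shows "Poly_Mapping.lookup (sum_list (map (raising_mon n1 n2) zs)) v
    = (\<Sum>z\<in>vars n - {VX 1}. count_list zs z * Poly_Mapping.lookup (raising_mon n1 n2 z) v)"
proof -
  have "Poly_Mapping.lookup (sum_list (map (raising_mon n1 n2) zs)) v
      = sum_list (map (\<lambda>z. Poly_Mapping.lookup (raising_mon n1 n2 z) v) zs)"
    by (induction zs) (simp_all add: lookup_add)
  then show ?thesis using assms by (simp add: sum_list_map_eq_sum_count2)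
qed

text \<open>
  The multiplicative independence of the raising monomials. For \<open>j \<noteq> 1\<close>, the variables \<open>x\<^sub>j\<close> and \<open>y\<^sub>j\<close> occur
  only in the raising monomials of \<open>x\<^sub>j\<close> and \<open>y\<^sub>j\<close>, and at least one of the two variables occurs in exactly
  one of these monomials. Comparing exponents at that variable first, and then at the other one, recovers both
  multiplicities. For \<open>j = 1\<close>, only \<open>y\<^sub>1\<close> is an index, and it occurs in no other raising monomial than its own.
\<close>

lemma count_list_determined_by_raising_mon:
  assumes n: "1 \<le> n1" "n1 \<le> n2"
    and zs: "set zs \<subseteq> vars n - {VX 1}" "set zs' \<subseteq> vars n - {VX 1}"
    and eq: "sum_list (map (raising_mon n1 n2) zs) = sum_list (map (raising_mon n1 n2) zs')"
    and z: "z \<in> vars n - {VX 1}"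
  shows "count_list zs z = count_list zs' z"
proof -
  let ?V = "vars n - {VX 1}"
  \<comment> \<open>The second summands are the products \<open>x\<^sub>j y\<^sub>j\<close>, where a variable occurs in the raising monomial of its partner.\<close>
  have lx: "Poly_Mapping.lookup (raising_mon n1 n2 z) (VX j)
      = (if z = VX j then 1 else 0) + (if z = VY j \<and> n2 < j then 1 else 0)" if "j \<noteq> 1" for z j
    using that n by (cases z) (auto simp: lookup_add lookup_single)
  have ly: "Poly_Mapping.lookup (raising_mon n1 n2 z) (VY j)
      = (if z = VY j then 1 else 0) + (if z = VX j \<and> j \<le> n1 then 1 else 0)" for z j
    using n by (cases z) (auto simp: lookup_add lookup_single)
  have X: "Poly_Mapping.lookup (sum_list (map (raising_mon n1 n2) zs)) (VX j)
      = count_list zs (VX j) + (if n2 < j then count_list zs (VY j) else 0)"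
    if "j \<noteq> 1" "j \<in> {1..n}" "set zs \<subseteq> ?V" for j zs
    unfolding lookup_sum_list_raising[OF that(3)] lx[OF that(1)] using that
    by (cases "n2 < j") (simp_all add: distrib_left sum.distrib if_distrib[of "(*) _"] sum.delta cong: if_cong)
  have Y: "Poly_Mapping.lookup (sum_list (map (raising_mon n1 n2) zs)) (VY j)
      = count_list zs (VY j) + (if j \<le> n1 \<and> j \<noteq> 1 then count_list zs (VX j) else 0)"
    if "j \<in> {1..n}" "set zs \<subseteq> ?V" for j zs
    unfolding lookup_sum_list_raising[OF that(2)] ly using that
    by (cases "j \<le> n1") (simp_all add: distrib_left sum.distrib if_distrib[of "(*) _"] sum.delta cong: if_cong)
  show ?thesis
  proof (cases z)
    case (VX j)
    then have j: "j \<noteq> 1" "j \<in> {1..n}" using z by auto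
    from X[OF j zs(1)] X[OF j zs(2)] Y[OF j(2) zs(1)] Y[OF j(2) zs(2)] eq VX n j
    show ?thesis by (cases "n2 < j"; cases "j \<le> n1") auto
  next
    case (VY j)
    then have j: "j \<in> {1..n}" using z by auto
    from X[OF _ j zs(1)] X[OF _ j zs(2)] Y[OF j zs(1)] Y[OF j zs(2)] eq VY n j
    show ?thesis by (cases "n2 < j"; cases "j \<le> n1"; cases "j = 1") auto
  qed
qed

lemma word_with_counts:
  assumes "finite V"
  obtains zs where "\<And>z. z \<in> V \<Longrightarrow> count_list zs z = e z" "set zs \<subseteq> V" "length zs = sum e V"
proof -
  obtain zs where zs: "mset zs = (\<Sum>z\<in>V. replicate_mset (e z) z)" using ex_mset by blast
  have "count (mset zs) z = (if z \<in> V then e z else 0)" for z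
    unfolding zs using assms by (simp add: count_sum sum.delta)
  then have *: "count_list zs z = (if z \<in> V then e z else 0)" for z by (simp add: count_mset)
  have sub: "set zs \<subseteq> V"
  proof
    fix z assume "z \<in> set zs"
    then have "count_list zs z \<noteq> 0" by (simp add: count_list_0_iff)
    then show "z \<in> V" using * by (auto split: if_splits)
  qed
  have "length zs = (\<Sum>z\<in>V. size (replicate_mset (e z) z))"
    unfolding size_mset[symmetric] zs by (rule size_multiset_sum)
  then have "length zs = sum e V" by simp
  with * sub show thesis by (intro that[of zs]) auto
qed

text \<open>
  The raising elements need not commute, so a fixed word \<open>W e\<close> is chosen for each vector \<open>e\<close> of multiplicities; the
  leading monomial of its value at \<open>f\<close> depends only on \<open>e\<close>. With all \<open>2n - 1\<close> multiplicities at most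
  \<open>k div (2n - 1)\<close>, the words have length at most \<open>k\<close>.
\<close>

lemma dim_env_filt_ge:
  assumes n: "1 \<le> n1" "n1 \<le> n2" "n2 \<le> n" and f: "f \<noteq> 0" "f \<in> M\<^sub>0"
    and fin: "env_filt poly_scale (osc n n1 n2) (sp n) k M\<^sub>0 \<subseteq> cpoly.span T" "finite T"
  shows "(k div (2 * n - 1) + 1) ^ (2 * n - 1) \<le> cpoly.dim (env_filt poly_scale (osc n n1 n2) (sp n) k M\<^sub>0)"
proof -
  let ?V = "vars n - {VX 1}" and ?U = "env_filt poly_scale (osc n n1 n2) (sp n) k M\<^sub>0"
  define d where "d = 2 * n - 1"
  define E where "E = PiE ?V (\<lambda>_. {..k div d})"
  have cardV: "card ?V = d" using n by (simp add: card_vars d_def)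
  have "\<exists>zs. (\<forall>z\<in>?V. count_list zs z = e z) \<and> set zs \<subseteq> ?V \<and> length zs = sum e ?V" for e
  proof -
    have "finite ?V" by simp
    then obtain zs where "\<And>z. z \<in> ?V \<Longrightarrow> count_list zs z = e z" "set zs \<subseteq> ?V" "length zs = sum e ?V"
      by (rule word_with_counts[of ?V e]) blast
    then show ?thesis by blast
  qed
  then obtain W where W: "\<And>e z. z \<in> ?V \<Longrightarrow> count_list (W e) z = e z"
    "\<And>e. set (W e) \<subseteq> ?V" "\<And>e. length (W e) = sum e ?V" by metis
  let ?p = "\<lambda>e. foldr (osc n n1 n2) (map (raising_elt n n1 n2) (W e)) f"
  note lead = lead_mon_raising_word[OF n W(2) f(1)]
  have inj: "inj_on (\<lambda>e. lead_mon (?p e)) E"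
  proof (rule inj_onI)
    fix e e' assume e: "e \<in> E" "e' \<in> E" and "lead_mon (?p e) = lead_mon (?p e')"
    then have "sum_list (map (raising_mon n1 n2) (W e)) = sum_list (map (raising_mon n1 n2) (W e'))"
      using lead by simp
    from count_list_determined_by_raising_mon[OF n(1,2) W(2) W(2) this] W(1)
    show "e = e'" using e unfolding E_def by (intro PiE_ext[of e _ _ e']) auto
  qed
  have finE: "finite E" unfolding E_def by (intro finite_PiE) auto
  have "inj_on lead_mon (?p ` E)" using inj by (auto simp: inj_on_def)
  then have "cpoly.independent (?p ` E)"
    using finE lead by (intro independent_if_lead_mons_distinct) auto
  moreover have "?p ` E \<subseteq> ?U"
  proof clarify
    fix e assume e: "e \<in> E"
    have "sum e ?V \<le> (\<Sum>z\<in>?V. k div d)" using e unfolding E_def by (intro sum_mono) auto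
    also have "\<dots> \<le> k" using cardV by simp
    finally have "length (W e) \<le> k" using W(3) by simp
    then show "?p e \<in> ?U"
      using W(2)[of e] raising_elt_in_sp[OF n] f by (intro osc.word_in_env_filt) auto
  qed
  ultimately have "card (?p ` E) \<le> cpoly.dim ?U"
    using fin by (intro cpoly.card_independent_le_dim)
  moreover have "card (?p ` E) = card E"
    using inj by (intro card_image) (auto simp: inj_on_def)
  moreover have "card E = (k div d + 1) ^ d"
    unfolding E_def using cardV by (simp add: card_PiE)
  ultimately show ?thesis by (simp add: d_def)
qed

section \<open>Gelfand-Kirillov dimension of submodules of weight spaces\<close>

text \<open>
  After taking logarithms, constant factors and shifts of \<open>k\<close> are negligible against \<open>ln k\<close>; the lower bound is at least
  \<open>(k / d)\<^bsup>d\<^esup>\<close>.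
\<close>

lemma ln_ratio_tendsto_exponent:
  fixes c :: "nat \<Rightarrow> nat"
  assumes d: "0 < d" and lower: "\<And>k. (k div d + 1) ^ d \<le> c k"
    and upper: "\<And>k. c k \<le> (N + 2 * k + 1) ^ d"
  shows "(\<lambda>k. ln (real (c k)) / ln (real k)) \<longlonglongrightarrow> real d"
proof (rule tendsto_sandwich)
  have "(\<lambda>k. (ln (real k) - ln (real d)) / ln (real k)) \<longlonglongrightarrow> 1" by real_asymp
  from tendsto_mult_left[OF this, of "real d"]
  show "(\<lambda>k. real d * ((ln (real k) - ln (real d)) / ln (real k))) \<longlonglongrightarrow> real d" by simp
  have "(\<lambda>k. ln (real N + 2 * real k + 1) / ln (real k)) \<longlonglongrightarrow> 1" by real_asymp
  from tendsto_mult_left[OF this, of "real d"]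
  show "(\<lambda>k. real d * (ln (real N + 2 * real k + 1) / ln (real k))) \<longlonglongrightarrow> real d" by simp
  have bounds: "real d * (ln (real k) - ln (real d)) \<le> ln (real (c k)) \<and>
      ln (real (c k)) \<le> real d * ln (real N + 2 * real k + 1)" if k: "2 \<le> k" for k
  proof
    have "k < (k div d + 1) * d"
      using dividend_less_div_times[OF d, of k] by (simp add: algebra_simps)
    then have "real k \<le> real ((k div d + 1) * d)" by (simp only: of_nat_le_iff less_imp_le)
    then have "real k / real d \<le> real (k div d + 1)"
      using d by (simp only: of_nat_mult divide_le_eq of_nat_0_less_iff if_True)
    then have "(real k / real d) ^ d \<le> real (k div d + 1) ^ d" by (intro power_mono) auto
    also have "\<dots> \<le> real (c k)" using lower[of k] by (metis of_nat_le_iff of_nat_power)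
    finally have *: "(real k / real d) ^ d \<le> real (c k)" .
    \<comment> \<open>Positivity is needed because \<open>ln\<close> is monotone only on positive numbers.\<close>
    have pos: "0 < (real k / real d) ^ d" using k d by simp
    then have "ln ((real k / real d) ^ d) \<le> ln (real (c k))" using * by simp
    then show "real d * (ln (real k) - ln (real d)) \<le> ln (real (c k))"
      using k d by (simp add: ln_realpow ln_div)
    have "real (c k) \<le> (real N + 2 * real k + 1) ^ d"
      using upper[of k] by (metis (mono_tags, lifting) of_nat_1 of_nat_add of_nat_le_iff of_nat_mult of_nat_numeral of_nat_power)
    then have "ln (real (c k)) \<le> ln ((real N + 2 * real k + 1) ^ d)"
      using * pos by (intro ln_mono) auto
    then show "ln (real (c k)) \<le> real d * ln (real N + 2 * real k + 1)"
      by (simp add: ln_realpow)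
  qed
  show "\<forall>\<^sub>F k in sequentially. real d * ((ln (real k) - ln (real d)) / ln (real k)) \<le> ln (real (c k)) / ln (real k)"
    using eventually_ge_at_top[of 2]
  proof eventually_elim
    case (elim k)
    with bounds[OF elim] show ?case by (simp add: divide_right_mono)
  qed
  show "\<forall>\<^sub>F k in sequentially. ln (real (c k)) / ln (real k) \<le> real d * (ln (real N + 2 * real k + 1) / ln (real k))"
    using eventually_ge_at_top[of 2]
  proof eventually_elim
    case (elim k)
    with bounds[OF elim] show ?case by (simp add: divide_right_mono)
  qed
qed

text \<open>
  Every finite-dimensional generating space \<open>M\<^sub>0\<close> satisfies both bounds: it has bounded degree,
  and it contains a nonzero vector because \<open>M\<close> is nonzero.
\<close>

lemma has_GK_dim_submodule_B_deg:
  assumes n: "1 \<le> n1" "n1 \<le> n2" "n2 \<le> n"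
    and M: "lie_submodule poly_scale (osc n n1 n2) (sp n) M" "M \<subseteq> B_deg n n1 n2 k'" "M \<noteq> {0}"
    and fg: "\<exists>M\<^sub>0. fin_dim_subspace poly_scale M\<^sub>0 \<and> env_gen poly_scale (osc n n1 n2) (sp n) M\<^sub>0 = M"
  shows "has_GK_dim poly_scale (osc n n1 n2) (sp n) M (ereal (2 * real n - 1))"
  unfolding has_GK_dim_def
proof (intro conjI allI impI)
  fix M\<^sub>0
  assume "fin_dim_subspace poly_scale M\<^sub>0 \<and> env_gen poly_scale (osc n n1 n2) (sp n) M\<^sub>0 = M"
  then obtain F where F: "finite F" "M\<^sub>0 = cpoly.span F"
    and gen: "env_gen poly_scale (osc n n1 n2) (sp n) M\<^sub>0 = M" by (auto simp: fin_dim_subspace_def)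
  let ?U = "\<lambda>k. env_filt poly_scale (osc n n1 n2) (sp n) k M\<^sub>0"
  have "M\<^sub>0 \<subseteq> M" using osc.subset_env_gen[of M\<^sub>0] gen by blast
  then have "F \<subseteq> B_deg n n1 n2 k'" using M(2) F(2) cpoly.span_superset[of F] by auto
  then obtain N where "F \<subseteq> wt_polys n n1 n2 k' N"
    using finite_subset_wt_polys[OF order_trans[OF n(2,3)] n(3) F(1)] by blast
  then have "M\<^sub>0 \<subseteq> wt_polys n n1 n2 k' N"
    unfolding F(2) by (intro cpoly.span_minimal subspace_wt_polys)
  note U = env_filt_wt_polys[OF this]
  have "\<exists>S. finite S \<and> card S \<le> (N + 2 * k + 1) ^ (2 * n - 1) \<and> ?U k \<subseteq> cpoly.span S" for k
  proof -
    obtain S where "finite S" "card S \<le> (N + 2 * k + 1) ^ (2 * n - 1)"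
      "wt_polys n n1 n2 k' (N + 2 * k) \<subseteq> cpoly.span S"
      using n by (auto intro: wt_polys_finite_span[of n "N + 2 * k" n1 n2 k'])
    then show ?thesis using U[of k] by blast
  qed
  then obtain S where S: "finite (S k)" "card (S k) \<le> (N + 2 * k + 1) ^ (2 * n - 1)"
    "?U k \<subseteq> cpoly.span (S k)" for k by metis
  have upper: "cpoly.dim (?U k) \<le> (N + 2 * k + 1) ^ (2 * n - 1)" for k
    using cpoly.dim_le_card[OF S(3,1), of k] S(2)[of k] by linarith
  \<comment> \<open>The zero subspace would only generate the zero submodule.\<close>
  have "\<exists>f\<in>M\<^sub>0. f \<noteq> 0"
  proof (rule ccontr)
    assume "\<not> (\<exists>f\<in>M\<^sub>0. f \<noteq> 0)"
    then have "M\<^sub>0 \<subseteq> {0}" by blast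
    moreover have "osc n n1 n2 A 0 = 0" for A
      using osc_scale[of n n1 n2 0 A 0] osc_linear[of n n1 n2 A]
        Vector_Spaces.linear.axioms(3) module_hom.zero by (metis Vector_Spaces.linear_def)
    then have "lie_submodule poly_scale (osc n n1 n2) (sp n) {0}"
      by (simp add: lie_submodule_def)
    ultimately have "M \<subseteq> {0}" using osc.env_gen_minimal gen by metis
    moreover have "0 \<in> M" using M(1) cpoly.subspace_0 by (auto simp: lie_submodule_def)
    ultimately show False using M(3) by blast
  qed
  then obtain f where f: "f \<noteq> 0" "f \<in> M\<^sub>0" by blast
  have lower: "(k div (2 * n - 1) + 1) ^ (2 * n - 1) \<le> cpoly.dim (?U k)" for k
    by (rule dim_env_filt_ge[OF n f S(3,1)])
  have "(\<lambda>k. ln (real (cpoly.dim (?U k))) / ln (real k)) \<longlonglongrightarrow> real (2 * n - 1)"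
    using n by (intro ln_ratio_tendsto_exponent[OF _ lower upper]) auto
  also have "real (2 * n - 1) = 2 * real n - 1" using n by (simp add: of_nat_diff)
  finally show "limsup (\<lambda>k. ereal (ln (real (cpoly.dim (?U k))) / ln (real k))) = ereal (2 * real n - 1)"
    by (intro lim_imp_Limsup) auto
qed (use M fg in auto)

section \<open>Finite generation for equal parameters\<close>

text \<open>
  The variables of weight \<open>-1\<close> and \<open>+1\<close> with index \<open>i\<close> for \<open>n1 = n2\<close>. The sign of \<open>x\<^sub>i\<close> in \<open>pos_var\<close> gives the
  multiplication operators of all index ranges the same form, that of \<open>sym_quadric\<close>.
\<close>

definition neg_var :: "nat \<Rightarrow> nat \<Rightarrow> cpoly" where
  "neg_var n1 i = (if i \<le> n1 then xv i else yv i)"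

definition pos_var :: "nat \<Rightarrow> nat \<Rightarrow> cpoly" where
  "pos_var n1 i = (if i \<le> n1 then yv i else - xv i)"

definition sym_quadric :: "nat \<Rightarrow> nat \<Rightarrow> nat \<Rightarrow> cpoly" where
  "sym_quadric n1 i j = neg_var n1 i * pos_var n1 j + neg_var n1 j * pos_var n1 i"

definition alt_quadric :: "nat \<Rightarrow> nat \<Rightarrow> nat \<Rightarrow> cpoly" where
  "alt_quadric n1 i j = neg_var n1 i * pos_var n1 j - neg_var n1 j * pos_var n1 i"

text \<open>
  Each factor on the left is the determinant of two rows of the form \<open>(u, v)\<close>, and the symmetric quadrics are the
  values on these rows of the bilinear form \<open>u v' + u' v\<close>. So the product of the two determinants is, up to
  the factor \<open>-1\<close> coming from the Gram determinant of this form, the determinant of a \<open>2 \<times> 2\<close> matrix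
  of symmetric quadrics.
\<close>

lemma alt_quadric_mult:
  "alt_quadric n1 i j * alt_quadric n1 k l
     = sym_quadric n1 i l * sym_quadric n1 j k - sym_quadric n1 i k * sym_quadric n1 j l"
  by (simp add: alt_quadric_def sym_quadric_def algebra_simps)

text \<open>
  Depending on the position of \<open>i\<close> and \<open>j\<close> relative to \<open>n1\<close>, the multiplication operator comes from the lower left,
  the diagonal or the upper right block of the symplectic matrices. On the diagonal \<open>i = j\<close> the quadric is twice
  a product, whence the sums of two equal terms.
\<close>

lemma sym_quadric_times_submodule:
  assumes N: "lie_submodule poly_scale (osc n n1 n1) (sp n) N" and p: "p \<in> N"
    and i: "i \<in> {1..n}" and j: "j \<in> {1..n}"
  shows "sym_quadric n1 i j * p \<in> N"
  using i j
proof (induction i j rule: linorder_wlog)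
  case (le i j)
  have sub: "cpoly.subspace N" and act: "\<And>A. A \<in> sp n \<Longrightarrow> osc n n1 n1 A p \<in> N"
    using N p by (auto simp: lie_submodule_def)
  note i = \<open>i \<in> {1..n}\<close> and j = \<open>j \<in> {1..n}\<close>
  consider "i = j" "i \<le> n1" | "i < j" "j \<le> n1" | "i \<le> n1" "n1 < j" | "i = j" "n1 < i" | "i < j" "n1 < i"
    using le.hyps by linarith
  then show ?case
  proof cases
    case 1
    have "Emat (n + i) i \<in> sp n" unfolding sp_def using i by (intro cmat.span_base) blast
    note o = act[OF this]
    have "sym_quadric n1 i j * p = - (osc n n1 n1 (Emat (n + i) i) p + osc n n1 n1 (Emat (n + i) i) p)"
      unfolding osc_E_low[OF i i] using 1
      by (simp add: Elow_def sym_quadric_def neg_var_def pos_var_def algebra_simps)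
    then show ?thesis using o by (simp only: cpoly.subspace_neg[OF sub] cpoly.subspace_add[OF sub])
  next
    case 2
    have "1 \<le> i \<and> i < j \<and> j \<le> n" using i j 2 by auto
    then have "Emat (n + i) j + Emat (n + j) i \<in> sp n" unfolding sp_def by (intro cmat.span_base) blast
    note o = act[OF this]
    have "sym_quadric n1 i j * p = - osc n n1 n1 (Emat (n + i) j + Emat (n + j) i) p"
      unfolding osc_add osc_E_low[OF i j] osc_E_low[OF j i] using 2
      by (simp add: Elow_def sym_quadric_def neg_var_def pos_var_def algebra_simps)
    then show ?thesis using o by (simp only: cpoly.subspace_neg[OF sub])
  next
    case 3
    have "Emat j i - Emat (n + i) (n + j) \<in> sp n" unfolding sp_def using i j
      by (intro cmat.span_base) blast
    note o = act[OF this]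
    have "sym_quadric n1 i j * p = osc n n1 n1 (Emat j i - Emat (n + i) (n + j)) p"
      unfolding osc_E_diag[OF j i] using 3
      by (simp add: Exx_def Eyy_def sym_quadric_def neg_var_def pos_var_def algebra_simps)
    then show ?thesis using o by simp
  next
    case 4
    have "Emat i (n + i) \<in> sp n" unfolding sp_def using i by (intro cmat.span_base) blast
    note o = act[OF this]
    have "sym_quadric n1 i j * p = osc n n1 n1 (Emat i (n + i)) p + osc n n1 n1 (Emat i (n + i)) p"
      unfolding osc_E_up[OF i i] using 4
      by (simp add: Eup_def sym_quadric_def neg_var_def pos_var_def algebra_simps)
    then show ?thesis using o by (simp only: cpoly.subspace_add[OF sub])
  next
    case 5
    have "1 \<le> i \<and> i < j \<and> j \<le> n" using i j 5 by auto
    then have "Emat i (n + j) + Emat j (n + i) \<in> sp n" unfolding sp_def by (intro cmat.span_base) blast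
    note o = act[OF this]
    have "sym_quadric n1 i j * p = osc n n1 n1 (Emat i (n + j) + Emat j (n + i)) p"
      unfolding osc_add osc_E_up[OF i j] osc_E_up[OF j i] using 5
      by (simp add: Eup_def sym_quadric_def neg_var_def pos_var_def algebra_simps)
    then show ?thesis using o by simp
  qed
next
  case (sym i j)
  then show ?case by (simp add: sym_quadric_def add.commute)
qed

text \<open>
  The induction step on monomials of weight 0: a nonconstant one contains variables of both weights,
  so a product of one of each splits off.
\<close>

lemma weight_zero_mon_cases:
  assumes m: "m \<in> wt_mons n n1 n1 0" "m \<noteq> 0"
  obtains i j m' where "i \<in> {1..n}" "j \<in> {1..n}" "m' \<in> wt_mons n n1 n1 0" "mon_deg n m' < mon_deg n m"
    "Poly_Mapping.single m 1 = neg_var n1 i * pos_var n1 j * Poly_Mapping.single m' 1 \<or>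
     Poly_Mapping.single m 1 = - (neg_var n1 i * pos_var n1 j * Poly_Mapping.single m' 1)"
proof -
  have keys: "Poly_Mapping.keys m \<subseteq> vars n" and wt: "mon_wt n n1 n1 m = 0"
    using m by (auto simp: wt_mons_def)
  have pm: "var_wt n1 n1 v = 1 \<or> var_wt n1 n1 v = -1" for v by (cases v) auto
  from m(2) obtain w where w: "Poly_Mapping.lookup m w \<noteq> 0" by (metis lookup_zero poly_mapping_eqI)
  then have "w \<in> vars n" using keys by (auto simp: in_keys_iff)
  then have pos: "0 < (\<Sum>v\<in>vars n. int (Poly_Mapping.lookup m v))"
    using w by (intro sum_pos2[of _ w]) auto
  \<comment> \<open>If no variable of weight \<open>c\<close> occurred, the weight of \<open>m\<close> would be \<open>- c\<close> times its positive degree.\<close>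
  have ex: "\<exists>v\<in>vars n. Poly_Mapping.lookup m v \<noteq> 0 \<and> var_wt n1 n1 v = c" if c: "c = 1 \<or> c = -1" for c
  proof (rule ccontr)
    assume "\<not> ?thesis"
    then have "var_wt n1 n1 v * int (Poly_Mapping.lookup m v) = - c * int (Poly_Mapping.lookup m v)"
      if "v \<in> vars n" for v using that pm[of v] c by auto
    then have "mon_wt n n1 n1 m = - c * (\<Sum>v\<in>vars n. int (Poly_Mapping.lookup m v))"
      by (simp add: mon_wt_def sum_distrib_left)
    then show False using wt pos c by auto
  qed
  obtain a where a: "a \<in> vars n" "Poly_Mapping.lookup m a \<noteq> 0" "var_wt n1 n1 a = -1"
    using ex[of "-1"] by blast
  obtain b where b: "b \<in> vars n" "Poly_Mapping.lookup m b \<noteq> 0" "var_wt n1 n1 b = 1"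
    using ex[of 1] by blast
  \<comment> \<open>Truncated subtraction loses nothing, since \<open>a\<close> and \<open>b\<close> are distinct variables of \<open>m\<close>.\<close>
  define m' where "m' = m - mon2 a b"
  have "a \<noteq> b" using a b by auto
  then have mm: "m = mon2 a b + m'" unfolding m'_def using a b
    by (intro poly_mapping_eqI) (auto simp: lookup_add lookup_minus lookup_single when_def)
  have "Poly_Mapping.keys m' \<subseteq> Poly_Mapping.keys m"
    unfolding mm by (auto simp: in_keys_iff lookup_add)
  then have m': "m' \<in> wt_mons n n1 n1 0"
    using wt keys a b unfolding mm by (auto simp: wt_mons_def mon_wt_add mon_wt_var simp del: One_nat_def)
  have deg: "mon_deg n m' < mon_deg n m"
    unfolding mm using a b by (simp add: mon_deg_add mon_deg_var del: One_nat_def)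
  have sm: "Poly_Mapping.single m 1 = pvar a * pvar b * Poly_Mapping.single m' (1::complex)"
    unfolding mm by (simp add: mult_single)
  define ind where "ind v = (case v of VX i \<Rightarrow> i | VY i \<Rightarrow> i)" for v
  have i: "ind a \<in> {1..n}" "pvar a = neg_var n1 (ind a)"
    using a by (cases a; simp add: ind_def neg_var_def xv_def yv_def split: if_splits)+
  have j: "ind b \<in> {1..n}" "pvar b = pos_var n1 (ind b) \<or> pvar b = - pos_var n1 (ind b)"
    using b by (cases b; simp add: ind_def pos_var_def xv_def yv_def split: if_splits)+
  show thesis
    by (rule that[OF i(1) j(1) m' deg]) (use sm i(2) j(2) in auto)
qed

text \<open>
  The idea is to strengthen membership in \<open>N\<close> to the set \<open>N'\<close> of those \<open>p\<close> for which all \<open>alt_quadric n1 i j * p\<close> are in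
  \<open>N\<close> as well. This set is closed under multiplication by symmetric quadrics, and also by alternating
  ones, because two alternating factors can be traded for symmetric ones. It is therefore closed under
  multiplication by the products \<open>neg_var n1 i * pos_var n1 j\<close>, and since it contains 1, it contains every
  monomial of weight 0.
\<close>

lemma B_deg_0_subset_submodule:
  assumes "n1 \<le> n" and N: "lie_submodule poly_scale (osc n n1 n1) (sp n) N"
    and one: "1 \<in> N" and alt: "\<And>i j. i \<in> {1..n} \<Longrightarrow> j \<in> {1..n} \<Longrightarrow> alt_quadric n1 i j \<in> N"
  shows "B_deg n n1 n1 0 \<subseteq> N"
proof -
  have sub: "cpoly.subspace N" using N by (simp add: lie_submodule_def)
  define N' where "N' = {p \<in> N. \<forall>i\<in>{1..n}. \<forall>j\<in>{1..n}. alt_quadric n1 i j * p \<in> N}"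
  have sym: "sym_quadric n1 i j * p \<in> N" if "p \<in> N" "i \<in> {1..n}" "j \<in> {1..n}" for i j p
    using sym_quadric_times_submodule[OF N] that by blast
  \<comment> \<open>The product of two variables is the mean of its symmetric and alternating combinations.\<close>
  have half: "neg_var n1 i * pos_var n1 j * p
      = poly_scale (1/2) (sym_quadric n1 i j * p + alt_quadric n1 i j * p)" for i j p
  proof -
    let ?q = "neg_var n1 i * pos_var n1 j * p"
    have "sym_quadric n1 i j * p + alt_quadric n1 i j * p = ?q + ?q"
      by (simp add: sym_quadric_def alt_quadric_def algebra_simps)
    also have "poly_scale (1/2) (?q + ?q) = poly_scale (1/2 + 1/2) ?q"
      by (simp only: cpoly.scale_left_distrib cpoly.scale_right_distrib)
    finally show ?thesis by simp
  qed
  have step: "neg_var n1 i * pos_var n1 j * p \<in> N'"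
    if p: "p \<in> N'" and ij: "i \<in> {1..n}" "j \<in> {1..n}" for i j p
  proof -
    have "sym_quadric n1 i j * p + alt_quadric n1 i j * p \<in> N"
      using p ij sym by (intro cpoly.subspace_add[OF sub]) (auto simp: N'_def)
    moreover have "alt_quadric n1 k l * (sym_quadric n1 i j * p + alt_quadric n1 i j * p) \<in> N"
      if kl: "k \<in> {1..n}" "l \<in> {1..n}" for k l
    proof -
      have "alt_quadric n1 k l * (sym_quadric n1 i j * p + alt_quadric n1 i j * p)
        = sym_quadric n1 i j * (alt_quadric n1 k l * p) + (alt_quadric n1 k l * alt_quadric n1 i j) * p"
        by (simp add: algebra_simps)
      also have "\<dots> = sym_quadric n1 i j * (alt_quadric n1 k l * p)
          + (sym_quadric n1 k j * (sym_quadric n1 l i * p) - sym_quadric n1 k i * (sym_quadric n1 l j * p))"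
        unfolding alt_quadric_mult by (simp add: algebra_simps)
      also have "\<dots> \<in> N"
        using p ij kl sym
        by (intro cpoly.subspace_add[OF sub] cpoly.subspace_diff[OF sub]) (auto simp: N'_def)
      finally show ?thesis .
    qed
    ultimately show ?thesis
      unfolding half N'_def by (auto simp: mult_scale intro: cpoly.subspace_scale[OF sub])
  qed
  have "Poly_Mapping.single m 1 \<in> N'" if "m \<in> wt_mons n n1 n1 0" for m
    using that
  proof (induction "mon_deg n m" arbitrary: m rule: less_induct)
    case less
    show ?case
    proof (cases "m = 0")
      case True
      then show ?thesis using one alt by (simp add: N'_def)
    next
      case False
      from weight_zero_mon_cases[OF less.prems this] obtain i j m' where
        ij: "i \<in> {1..n}" "j \<in> {1..n}" and m': "m' \<in> wt_mons n n1 n1 0" "mon_deg n m' < mon_deg n m"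
        and eq: "Poly_Mapping.single m 1 = neg_var n1 i * pos_var n1 j * Poly_Mapping.single m' 1 \<or>
          Poly_Mapping.single m 1 = - (neg_var n1 i * pos_var n1 j * Poly_Mapping.single m' 1)" .
      have "neg_var n1 i * pos_var n1 j * Poly_Mapping.single m' 1 \<in> N'"
        using step[OF less.hyps[OF m'(2,1)] ij] .
      moreover have "- q \<in> N'" if "q \<in> N'" for q
        using that cpoly.subspace_neg[OF sub] by (auto simp: N'_def)
      ultimately show ?thesis using eq by auto
    qed
  qed
  then show ?thesis
    unfolding B_deg_span[OF assms(1,1)]
    by (intro cpoly.span_minimal sub) (auto simp: N'_def)
qed

lemma wt_polys_subset_B_deg:
  "n1 \<le> n \<Longrightarrow> n2 \<le> n \<Longrightarrow> wt_polys n n1 n2 k N \<subseteq> B_deg n n1 n2 k"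
  by (auto simp: wt_polys_def B_deg_keys)

lemma one_in_wt_polys: "1 \<in> wt_polys n n1 n2 0 0"
  by (auto simp: wt_polys_def wt_mons_def mon_wt_def mon_deg_def)

lemma one_in_B_deg: "n1 \<le> n \<Longrightarrow> n2 \<le> n \<Longrightarrow> 1 \<in> B_deg n n1 n2 0"
  using wt_polys_subset_B_deg one_in_wt_polys by blast

lemma alt_quadric_in_B_deg:
  assumes "n1 \<le> n" "i \<in> {1..n}" "j \<in> {1..n}"
  shows "alt_quadric n1 i j \<in> B_deg n n1 n1 0"
proof -
  note sub = subspace_wt_polys[of n n1 n1 0 "Suc (Suc 0)"]
  have "neg_var n1 i * pos_var n1 j \<in> wt_polys n n1 n1 0 (Suc (Suc 0))" if "i \<in> {1..n}" "j \<in> {1..n}" for i j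
    using that quadratic_wt_polys(1)[OF one_in_wt_polys[of n n1 n1], of "if i \<le> n1 then VX i else VY i" "if j \<le> n1 then VY j else VX j"]
    by (auto simp: neg_var_def pos_var_def xv_def yv_def intro!: cpoly.subspace_neg[OF sub]
      simp del: One_nat_def split: if_splits)
  then have "alt_quadric n1 i j \<in> wt_polys n n1 n1 0 (Suc (Suc 0))"
    unfolding alt_quadric_def using assms by (intro cpoly.subspace_diff[OF sub])
  then show ?thesis using wt_polys_subset_B_deg[OF assms(1,1)] by blast
qed

lemma B_deg_0_finitely_generated:
  assumes "n1 \<le> n"
  shows "\<exists>M\<^sub>0. fin_dim_subspace poly_scale M\<^sub>0 \<and>
    env_gen poly_scale (osc n n1 n1) (sp n) M\<^sub>0 = B_deg n n1 n1 0"
proof -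
  let ?F = "insert 1 ((\<lambda>(i, j). alt_quadric n1 i j) ` ({1..n} \<times> {1..n}))"
  let ?G = "env_gen poly_scale (osc n n1 n1) (sp n) ?F"
  have "?F \<subseteq> B_deg n n1 n1 0"
    using one_in_B_deg alt_quadric_in_B_deg assms by auto
  then have "?G \<subseteq> B_deg n n1 n1 0"
    by (intro osc.env_gen_minimal lie_submodule_B_deg assms)
  moreover have "B_deg n n1 n1 0 \<subseteq> ?G"
  proof (rule B_deg_0_subset_submodule[OF assms osc.lie_submodule_env_gen])
    have "?F \<subseteq> ?G" by (rule osc.subset_env_gen)
    then show "1 \<in> ?G" by blast
    fix i j assume "i \<in> {1..n}" "j \<in> {1..n}"
    then have "(i, j) \<in> {1..n} \<times> {1..n}" by blast
    then have "alt_quadric n1 i j \<in> ?F" by (intro insertI2 image_eqI[of _ _ "(i, j)"]) auto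
    with \<open>?F \<subseteq> ?G\<close> show "alt_quadric n1 i j \<in> ?G" by (rule subsetD)
  qed
  ultimately show ?thesis using osc.finitely_generated_env_gen[of ?F n n1 n1] by auto
qed

section \<open>Submodules generated by one vector\<close>

lemma has_GK_dim_env_gen_singleton:
  assumes "1 \<le> n1" "n1 \<le> n2" "n2 \<le> n" "f \<in> B_deg n n1 n2 k" "f \<noteq> 0"
  shows "has_GK_dim poly_scale (osc n n1 n2) (sp n)
    (env_gen poly_scale (osc n n1 n2) (sp n) {f}) (ereal (2 * real n - 1))"
proof (rule has_GK_dim_submodule_B_deg[OF assms(1-3) osc.lie_submodule_env_gen])
  show "env_gen poly_scale (osc n n1 n2) (sp n) {f} \<subseteq> B_deg n n1 n2 k"
    using assms by (intro osc.env_gen_minimal lie_submodule_B_deg) auto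
  show "env_gen poly_scale (osc n n1 n2) (sp n) {f} \<noteq> {0}"
    using assms(5) osc.subset_env_gen[of "{f}" n n1 n2] by blast
qed (rule osc.finitely_generated_env_gen, simp)

text \<open>
  Its two monomials \<open>x\<^sub>i y\<^sub>j\<close> and \<open>x\<^sub>j y\<^sub>i\<close> differ, so they do not cancel.
\<close>

lemma alt_quadric_nonzero:
  assumes "i \<noteq> j" "i \<le> n1" "j \<le> n1"
  shows "alt_quadric n1 i j \<noteq> 0"
proof -
  have "mon2 (VX j) (VY i) \<noteq> mon2 (VX i) (VY j)"
    using assms(1) by (auto simp: poly_mapping_eq_iff fun_eq_iff lookup_add lookup_single when_def
      dest: spec[of _ "VX i"])
  then have "Poly_Mapping.lookup (alt_quadric n1 i j) (mon2 (VX i) (VY j)) = 1"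
    using assms by (simp add: alt_quadric_def neg_var_def pos_var_def xv_def yv_def mult_single
      lookup_minus lookup_single)
  then show ?thesis by auto
qed

theorem theorem1p3:
  fixes n n1 n2 :: nat
  assumes "1 \<le> n" and "1 \<le> n1" and "n1 \<le> n2" and "n2 \<le> n"
  shows "(\<forall>k'::int. lie_irreducible poly_scale (osc n n1 n2) (sp n) (B_deg n n1 n2 k') \<longrightarrow>
            has_GK_dim poly_scale (osc n n1 n2) (sp n) (B_deg n n1 n2 k') (ereal (2 * real n - 1)))
       \<and> (n1 = n2 \<longrightarrow>
            has_GK_dim poly_scale (osc n n1 n2) (sp n) (B_deg n n1 n2 0) (ereal (2 * real n - 1)))
       \<and> (n1 = n \<and> n2 = n \<longrightarrow>
            (\<forall>M N. irreducible_components poly_scale (osc n n1 n2) (sp n) (B_deg n n1 n2 0) M N \<longrightarrow>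
               has_GK_dim poly_scale (osc n n1 n2) (sp n) M (ereal (2 * real n - 1)) \<and>
               has_GK_dim poly_scale (osc n n1 n2) (sp n) N (ereal (2 * real n - 1)))
          \<and> has_GK_dim poly_scale (osc n n1 n2) (sp n)
              (env_gen poly_scale (osc n n1 n2) (sp n) {1}) (ereal (2 * real n - 1))
          \<and> (2 \<le> n \<longrightarrow> has_GK_dim poly_scale (osc n n1 n2) (sp n)
              (env_gen poly_scale (osc n n1 n2) (sp n) {xv (n - 1) * yv n - xv n * yv (n - 1)})
              (ereal (2 * real n - 1))))"
proof -
  note n = assms(2-4)
  have irr: "has_GK_dim poly_scale (osc n n1 n2) (sp n) M (ereal (2 * real n - 1))"
    if "lie_irreducible poly_scale (osc n n1 n2) (sp n) M" "M \<subseteq> B_deg n n1 n2 k" for M k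
    using has_GK_dim_submodule_B_deg[OF n _ that(2)] osc.irreducible_finitely_generated[OF that(1)] that(1)
    by (simp add: lie_irreducible_def)
  have whole: "has_GK_dim poly_scale (osc n n1 n2) (sp n) (B_deg n n1 n2 0) (ereal (2 * real n - 1))"
    if "n1 = n2"
  proof -
    have "1 \<in> B_deg n n1 n1 0" using one_in_B_deg n by auto
    then have "B_deg n n1 n1 0 \<noteq> {0}" by (metis singletonD zero_neq_one)
    then show ?thesis
      using has_GK_dim_submodule_B_deg[OF n lie_submodule_B_deg subset_refl] B_deg_0_finitely_generated[of n1 n]
        n that by simp
  qed
  have comps: "has_GK_dim poly_scale (osc n n1 n2) (sp n) M (ereal (2 * real n - 1)) \<and>
      has_GK_dim poly_scale (osc n n1 n2) (sp n) N (ereal (2 * real n - 1))"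
    if MN: "irreducible_components poly_scale (osc n n1 n2) (sp n) (B_deg n n1 n2 0) M N" for M N
  proof -
    have "0 \<in> M" "0 \<in> N" and sum: "{u + v | u v. u \<in> M \<and> v \<in> N} = B_deg n n1 n2 0"
      using MN cpoly.subspace_0
      by (auto simp: irreducible_components_def lie_irreducible_def lie_submodule_def)
    then have "M \<subseteq> B_deg n n1 n2 0" "N \<subseteq> B_deg n n1 n2 0"
      by (force simp flip: sum)+
    then show ?thesis using MN irr by (auto simp: irreducible_components_def)
  qed
  have one: "has_GK_dim poly_scale (osc n n1 n2) (sp n)
      (env_gen poly_scale (osc n n1 n2) (sp n) {1}) (ereal (2 * real n - 1))"
    using n one_in_B_deg by (intro has_GK_dim_env_gen_singleton[where k = 0]) auto
  have alt: "has_GK_dim poly_scale (osc n n1 n2) (sp n)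
      (env_gen poly_scale (osc n n1 n2) (sp n) {xv (n - 1) * yv n - xv n * yv (n - 1)})
      (ereal (2 * real n - 1))" if "n1 = n" "n2 = n" "2 \<le> n"
  proof -
    have "xv (n - 1) * yv n - xv n * yv (n - 1) = alt_quadric n (n - 1) n"
      by (simp add: alt_quadric_def neg_var_def pos_var_def)
    moreover have "alt_quadric n (n - 1) n \<noteq> 0" using that by (intro alt_quadric_nonzero) auto
    moreover have "alt_quadric n (n - 1) n \<in> B_deg n n n 0" using that by (intro alt_quadric_in_B_deg) auto
    ultimately show ?thesis
      using n that by (intro has_GK_dim_env_gen_singleton[where k = 0]) auto
  qed
  show ?thesis using irr whole comps one alt by blast
qed

end
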